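(* Let $\Lambda:=\{(a,b\sqrt3)\in\mathbb{R}^2: 2a,2b,a+b\in\mathbb{Z}\}$ and \[T:=\operatorname{conv}\left(\left(-\tfrac47,\tfrac{2\sqrt3}7\right),\left(\tfrac{17}{14},\tfrac{9\sqrt3}{14}\right),\left(\tfrac67,-\tfrac{3\sqrt3}7\right)\right)\] (which contains the origin). Let $T^{\oplus7}:=\bigoplus_{i=1}^7 7T\subset\mathbb{R}^{14}$ be the direct sum of seven copies of $7T$, considered with respect to the lattice $\Lambda^7$. Then $T^{\oplus 7}$ is a $14$-dimensional lattice polytope, hollow with respect to $\Lambda^7$, of lattice width $15$. It has $21$ vertices and $2^7+7$ facets, namely $2^7$ simplices and seven facets combinatorially of the form segment$\oplus$triangle$^{\oplus6}$.
   Context: The direct sum of convex bodies $C_i\subset\mathbb{R}^{d_i}$ containing the origin is $\{(\lambda_1x_1,\dots,\lambda_mx_m): x_i\in C_i,\ \lambda_i\ge0,\ \sum\lambda_i=1\}$. $kC$ denotes dilation by factor $k$. A lattice polytope has its vertices in the lattice; a convex body is hollow if its interior contains no lattice point. The lattice width with respect to a lattice $L$ is $\inf_{f\in L^*\setminus\{0\}}$ of the length of $f(K)$, $L^*$ the dual lattice. *)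

theory Defs
  imports "HOL-Analysis.Analysis"
begin

text \<open>The direct sum depends on the position of the origin in the summands.  The ambient space
  of a family of sets in \<open>'a\<close> is \<open>'a ^ 'i\<close>; \<open>direct_sum2\<close> allows two different ambient spaces.\<close>

definition direct_sum :: "('i::finite \<Rightarrow> 'a::real_vector set) \<Rightarrow> ('a ^ 'i) set" where
  "direct_sum C =
     {(\<chi> i. l i *\<^sub>R x i) | l x. (\<forall>i. x i \<in> C i) \<and> (\<forall>i. 0 \<le> l i) \<and> (\<Sum>i\<in>UNIV. l i) = 1}"

definition direct_sum2 :: "'a::real_vector set \<Rightarrow> 'b::real_vector set \<Rightarrow> ('a \<times> 'b) set" where
  "direct_sum2 A B =
     {(s *\<^sub>R x, t *\<^sub>R y) | s t x y. x \<in> A \<and> y \<in> B \<and> 0 \<le> s \<and> 0 \<le> t \<and> s + t = 1}"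

definition dilate :: "real \<Rightarrow> 'a::real_vector set \<Rightarrow> 'a set" where
  "dilate k C = (\<lambda>x. k *\<^sub>R x) ` C"

definition lattice_polytope :: "'a::euclidean_space set \<Rightarrow> 'a set \<Rightarrow> bool" where
  "lattice_polytope L P \<longleftrightarrow> polytope P \<and> {v. v extreme_point_of P} \<subseteq> L"

definition hollow :: "'a::euclidean_space set \<Rightarrow> 'a set \<Rightarrow> bool" where
  "hollow L K \<longleftrightarrow> interior K \<inter> L = {}"

definition dual_lattice :: "'a::euclidean_space set \<Rightarrow> ('a \<Rightarrow> real) set" where
  "dual_lattice L = {f. linear f \<and> (\<forall>x\<in>L. f x \<in> \<int>)}"

text \<open>For nonempty compact convex \<open>K\<close> the set \<open>f ` K\<close> is a closed interval, and its length is
  the difference of its supremum and infimum.\<close>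

definition lattice_width :: "'a::euclidean_space set \<Rightarrow> 'a set \<Rightarrow> real" where
  "lattice_width L K = (INF f \<in> dual_lattice L - {\<lambda>_. 0}. Sup (f ` K) - Inf (f ` K))"

text \<open>Isomorphism of face lattices; \<open>face_of\<close> counts the empty set and the whole set as faces.\<close>

definition combinatorially_equivalent ::
    "'a::real_vector set \<Rightarrow> 'b::real_vector set \<Rightarrow> bool" where
  "combinatorially_equivalent P Q \<longleftrightarrow>
     (\<exists>\<phi>. bij_betw \<phi> {F. F face_of P} {G. G face_of Q} \<and>
        (\<forall>F F'. F face_of P \<longrightarrow> F' face_of P \<longrightarrow> (F \<subseteq> F' \<longleftrightarrow> \<phi> F \<subseteq> \<phi> F')))"

definition Lambda :: "(real ^ 2) set" where
  "Lambda = {vector [a, b * sqrt 3] | a b. 2 * a \<in> \<int> \<and> 2 * b \<in> \<int> \<and> a + b \<in> \<int>}"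

definition Lambda7 :: "((real ^ 2) ^ 7) set" where
  "Lambda7 = {x. \<forall>i. x $ i \<in> Lambda}"

definition T :: "(real ^ 2) set" where
  "T = convex hull
     {vector [- 4 / 7, 2 * sqrt 3 / 7],
      vector [17 / 14, 9 * sqrt 3 / 14],
      vector [6 / 7, - (3 * sqrt 3) / 7]}"

definition T7 :: "((real ^ 2) ^ 7) set" where
  "T7 = direct_sum (\<lambda>_. dilate 7 T)"

text \<open>The origin lies in the relative interior of an edge of \<open>T\<close>.  Accordingly the form
  segment \<open>\<oplus>\<close> triangle\<open>\<oplus>\<dots>\<oplus>\<close> triangle (six triangles) is read with the origin inside the
  segment and with the triangles placed as \<open>7T\<close> is: the combinatorial type of a direct sum
  depends on which faces of the summands contain the origin, but otherwise not on the choice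
  of the segment and the triangles.\<close>

definition segment_triangles6 :: "'a::real_vector set \<Rightarrow> bool" where
  "segment_triangles6 F \<longleftrightarrow>
     (\<exists>a b :: real. a < 0 \<and> 0 < b \<and>
        combinatorially_equivalent F
          (direct_sum2 (closed_segment a b) (direct_sum (\<lambda>_ :: 6. dilate 7 T))))"

end

(*
  The triangle P = 7T is cut out by an inequality through the origin (the edge AC contains 0) and
  two inequalities with right-hand side 1, whose maximum is the gauge of P on the half plane
  above AC.  A direct sum of copies of P is therefore given by the half plane conditions together
  with "sum of the gauges \<le> 1", and expanding the maxima turns this into one inequality for every
  choice of AB or BC in each summand.  These inequalities are irredundant, so they give the facets:
  2^n for the choices, n for the edges through 0.

  Hollowness: a lattice point in the interior has a summand of gauge below 1/7 strictly above AC,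
  that is, a lattice point in the interior of T, and there is none.  Width: every
  summand is contained in the direct sum, and a nonzero integral functional is nonzero on one of
  them, where its values at A, B, C are -2p, 13p + 35q, 3p with integers p, q not both 0.

  The two kinds of facets are separated by the face lattice.  In a segment (+) triangles facet the
  join of the two ends of the segment contains 0, hence the whole edge AC of every triangle; in the
  Boolean face lattice of a simplex no join of two faces contains a vertex outside both.
*)

theory Submission
  imports Defs
begin

section \<open>The triangle and direct sums of its copies\<close>

definition vertA :: "real ^ 2" where "vertA = vector [- 4, 2 * sqrt 3]"
definition vertB :: "real ^ 2" where "vertB = vector [17 / 2, 9 * sqrt 3 / 2]"
definition vertC :: "real ^ 2" where "vertC = vector [6, - (3 * sqrt 3)]"
text \<open>The normals of AB and BC are scaled so that their edges lie at level 1. The edge AC lies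
  at level 0, and its normal points into the triangle.\<close>

definition normalAC :: "real ^ 2" where "normalAC = vector [1, 2 / sqrt 3]"
definition normalAB :: "real ^ 2" where "normalAB = vector [- 1 / 14, 5 / (14 * sqrt 3)]"
definition normalBC :: "real ^ 2" where "normalBC = vector [1 / 7, - 1 / (21 * sqrt 3)]"

lemmas triangle_defs = vertA_def vertB_def vertC_def normalAC_def normalAB_def normalBC_def

lemma inner_real2: "x \<bullet> y = x $ 1 * y $ 1 + x $ 2 * y $ 2" for x y :: "real ^ 2"
  by (simp add: inner_vec_def sum_2)

lemma normals_vertices [simp]:
  "normalAC \<bullet> vertA = 0" "normalAC \<bullet> vertB = 35 / 2" "normalAC \<bullet> vertC = 0"
  "normalAB \<bullet> vertA = 1" "normalAB \<bullet> vertB = 1" "normalAB \<bullet> vertC = - 3 / 2"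
  "normalBC \<bullet> vertA = - 2 / 3" "normalBC \<bullet> vertB = 1" "normalBC \<bullet> vertC = 1"
  by (simp_all add: triangle_defs inner_real2)

text \<open>Coordinates in the basis formed by the two ends of an edge, written through the normals.
  They recover a point from its levels.\<close>

lemma real2_decomp_AB: "x = (normalAB \<bullet> x - 2 / 35 * (normalAC \<bullet> x)) *\<^sub>R vertA + (2 / 35 * (normalAC \<bullet> x)) *\<^sub>R vertB"
  and real2_decomp_BC: "x = (normalBC \<bullet> x - 2 / 35 * (normalAC \<bullet> x)) *\<^sub>R vertC + (2 / 35 * (normalAC \<bullet> x)) *\<^sub>R vertB"
  by (simp_all add: triangle_defs inner_real2 vec_eq_iff forall_2 field_simps)

text \<open>Three vectors in the plane are linearly dependent. The signs here make a positive
  combination of the AB and BC levels nonnegative above the line AC.\<close>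

lemma normals_relation: "14 * (normalAB \<bullet> x) + 21 * (normalBC \<bullet> x) = 2 * (normalAC \<bullet> x)"
  by (simp add: triangle_defs inner_real2 field_simps)

abbreviation P :: "(real ^ 2) set" where "P \<equiv> dilate 7 T"

lemma P_eq_hull: "P = convex hull {vertA, vertB, vertC}"
proof -
  have "P = convex hull ((\<lambda>x. 7 *\<^sub>R x) ` {vector [- 4 / 7, 2 * sqrt 3 / 7],
      vector [17 / 14, 9 * sqrt 3 / 14], vector [6 / 7, - (3 * sqrt 3) / 7]})"
    unfolding dilate_def T_def convex_hull_scaling ..
  also have "(\<lambda>x. 7 *\<^sub>R x) ` {vector [- 4 / 7, 2 * sqrt 3 / 7],
      vector [17 / 14, 9 * sqrt 3 / 14], vector [6 / 7, - (3 * sqrt 3) / 7]} = {vertA, vertB, vertC}"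
  proof -
    have "7 *\<^sub>R vector [- 4 / 7, 2 * sqrt 3 / 7] = vertA"
      "7 *\<^sub>R vector [17 / 14, 9 * sqrt 3 / 14] = vertB"
      "7 *\<^sub>R vector [6 / 7, - (3 * sqrt 3) / 7] = vertC"
      by (simp_all add: triangle_defs vec_eq_iff forall_2)
    then show ?thesis
      by (simp only: image_insert image_empty)
  qed
  finally show ?thesis .
qed

lemma P_eq: "P = {x. 0 \<le> normalAC \<bullet> x \<and> normalAB \<bullet> x \<le> 1 \<and> normalBC \<bullet> x \<le> 1}" (is "_ = ?H")
proof
  have "?H = {x. normalAC \<bullet> x \<ge> 0} \<inter> {x. normalAB \<bullet> x \<le> 1} \<inter> {x. normalBC \<bullet> x \<le> 1}"
    by auto
  then have "convex ?H"
    by (simp add: convex_Int convex_halfspace_ge convex_halfspace_le)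
  then show "P \<subseteq> ?H"
    unfolding P_eq_hull by (intro hull_minimal) auto
next
  show "?H \<subseteq> P"
  proof
    fix x assume x: "x \<in> ?H"
    \<comment> \<open>Barycentric coordinates: the coefficient of a vertex is the slack in the
      inequality of the opposite edge, scaled to 1 at that vertex.\<close>
    have "x = (3 / 5 * (1 - normalBC \<bullet> x)) *\<^sub>R vertA + (2 / 35 * (normalAC \<bullet> x)) *\<^sub>R vertB
        + (2 / 5 * (1 - normalAB \<bullet> x)) *\<^sub>R vertC"
      by (simp add: triangle_defs inner_real2 vec_eq_iff forall_2 field_simps)
    moreover have "3 / 5 * (1 - normalBC \<bullet> x) + 2 / 35 * (normalAC \<bullet> x) + 2 / 5 * (1 - normalAB \<bullet> x) = 1"
      using normals_relation[of x] by (simp add: field_simps)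
    ultimately show "x \<in> P"
      unfolding P_eq_hull convex_hull_3 using x by (smt (verit, best) mem_Collect_eq mult_nonneg_nonneg divide_nonneg_pos)
  qed
qed

lemma zero_in_P: "0 \<in> P"
  by (simp add: P_eq)

lemma vertices_in_P: "vertA \<in> P" "vertB \<in> P" "vertC \<in> P"
  by (simp_all add: P_eq)

text \<open>Agrees with the Minkowski gauge of \<open>P\<close> only where
  \<open>0 \<le> normalAC \<bullet> x\<close>. Elsewhere it can be negative, for instance at
  \<open>- vertB\<close>, so the half plane condition has to be carried along.\<close>

definition gaugeP :: "real ^ 2 \<Rightarrow> real" where
  "gaugeP x = max (normalAB \<bullet> x) (normalBC \<bullet> x)"

lemma gaugeP_scale: "0 \<le> c \<Longrightarrow> gaugeP (c *\<^sub>R x) = c * gaugeP x"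
  by (simp add: gaugeP_def max_mult_distrib_left)

lemma P_eq_gaugeP: "P = {x. 0 \<le> normalAC \<bullet> x \<and> gaugeP x \<le> 1}"
  by (auto simp: P_eq gaugeP_def)

text \<open>By \<open>normals_relation\<close> the two levels cannot both be negative.\<close>

lemma gaugeP_nonneg: "0 \<le> normalAC \<bullet> x \<Longrightarrow> 0 \<le> gaugeP x"
  using normals_relation[of x] by (auto simp: gaugeP_def max_def)

text \<open>Two nonpositive levels with a nonnegative positive combination must vanish, and
  \<open>normalAC \<bullet> x\<close> vanishes with them.\<close>

lemma gaugeP_eq_0D:
  assumes "0 \<le> normalAC \<bullet> x" "gaugeP x \<le> 0"
  shows "x = 0"
proof -
  have "normalAB \<bullet> x = 0" "normalAC \<bullet> x = 0"
    using assms normals_relation[of x] by (auto simp: gaugeP_def)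
  then show ?thesis
    using real2_decomp_AB[of x] by simp
qed

lemma scaled_in_P:
  assumes "0 \<le> normalAC \<bullet> x" "gaugeP x \<le> c"
  obtains y where "y \<in> P" "x = c *\<^sub>R y"
proof (cases "c = 0")
  case True
  then show ?thesis
    using gaugeP_eq_0D assms zero_in_P that[of 0] by simp
next
  case False
  then have c: "c > 0"
    using gaugeP_nonneg[OF assms(1)] assms(2) by simp
  have "inverse c *\<^sub>R x \<in> P"
    using assms c by (simp add: P_eq_gaugeP gaugeP_scale field_simps)
  then show ?thesis
    using that[of "inverse c *\<^sub>R x"] c by simp
qed

section \<open>Description of the direct sum by inequalities\<close>

text \<open>Each weight bounds the gauge of its component. Conversely, the gauges themselves serve
  as weights, up to slack.\<close>

lemma direct_sum_P_eq_gaugeP: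
  "direct_sum (\<lambda>_::'i::finite. P) = {x. (\<forall>i. 0 \<le> normalAC \<bullet> x $ i) \<and> (\<Sum>i\<in>UNIV. gaugeP (x $ i)) \<le> 1}"
    (is "?L = ?R")
proof
  show "?L \<subseteq> ?R"
  proof
    fix y assume "y \<in> ?L"
    then obtain l x where y: "y = (\<chi> i. l i *\<^sub>R x i)" and x: "\<And>i. x i \<in> P" and l: "\<And>i. 0 \<le> l i"
      and sum: "sum l UNIV = 1"
      unfolding direct_sum_def by blast
    have "gaugeP (y $ i) \<le> l i" for i
      using x[of i] l[of i] by (simp add: y gaugeP_scale P_eq_gaugeP mult_left_le)
    then have "(\<Sum>i\<in>UNIV. gaugeP (y $ i)) \<le> 1"
      using sum sum_mono[of UNIV "\<lambda>i. gaugeP (y $ i)" l] by simp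
    then show "y \<in> ?R"
      using x l by (simp add: y P_eq_gaugeP)
  qed
next
  show "?R \<subseteq> ?L"
  proof
    fix y assume y: "y \<in> ?R"
    \<comment> \<open>The weights must add up to exactly 1, so the slack is spread evenly over the summands.\<close>
    define d where "d = (1 - (\<Sum>i\<in>UNIV. gaugeP (y $ i))) / CARD('i)"
    define l where "l = (\<lambda>i. gaugeP (y $ i) + d)"
    have d: "0 \<le> d"
      using y by (simp add: d_def)
    have "\<exists>x\<in>P. y $ i = l i *\<^sub>R x" for i
      using scaled_in_P[of "y $ i" "l i"] y d by (auto simp: l_def)
    then obtain x where x: "\<And>i. x i \<in> P" "\<And>i. y $ i = l i *\<^sub>R x i"
      by metis
    have "sum l UNIV = 1"
      by (simp add: l_def sum.distrib d_def)
    moreover have "0 \<le> l i" for i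
      using y d gaugeP_nonneg by (simp add: l_def)
    moreover have "y = (\<chi> i. l i *\<^sub>R x i)"
      by (simp add: vec_eq_iff x(2))
    ultimately show "y \<in> ?L"
      unfolding direct_sum_def using x(1) by blast
  qed
qed

definition facet_normal :: "('i::finite \<Rightarrow> bool) \<Rightarrow> (real ^ 2) ^ 'i" where
  "facet_normal \<sigma> = (\<chi> i. if \<sigma> i then normalAB else normalBC)"

lemma facet_normal_inner: "facet_normal \<sigma> \<bullet> x = (\<Sum>i\<in>UNIV. (if \<sigma> i then normalAB else normalBC) \<bullet> x $ i)"
  by (simp add: facet_normal_def inner_vec_def)

lemma facet_normal_axis [simp]:
  "facet_normal \<sigma> \<bullet> axis i v = (if \<sigma> i then normalAB else normalBC) \<bullet> v"
  by (simp add: inner_axis facet_normal_def)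

lemma facet_normal_nonzero: "facet_normal \<sigma> \<noteq> 0"
proof -
  \<comment> \<open>Any index will do, since both normals take the value 1 at
    \<open>vertB\<close>.\<close>
  have "facet_normal \<sigma> \<bullet> axis undefined vertB \<noteq> 0"
    by simp
  then show ?thesis
    by (metis inner_zero_left)
qed

lemma normalAC_nonzero: "normalAC \<noteq> 0"
  by (simp add: normalAC_def vec_eq_iff forall_2)

lemma facet_normal_le_gaugeP: "facet_normal \<sigma> \<bullet> x \<le> (\<Sum>i\<in>UNIV. gaugeP (x $ i))"
  unfolding facet_normal_inner by (intro sum_mono) (simp add: gaugeP_def)

text \<open>Choosing the larger level in every summand turns the sum of maxima into a maximum over
  all choices.\<close>

lemma facet_normal_eq_gaugeP: "\<exists>\<sigma>. facet_normal \<sigma> \<bullet> x = (\<Sum>i\<in>UNIV. gaugeP (x $ i))"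
  by (rule exI[of _ "\<lambda>i. normalBC \<bullet> x $ i \<le> normalAB \<bullet> x $ i"])
    (auto simp: facet_normal_inner gaugeP_def max_def intro!: sum.cong)

lemma direct_sum_P_eq:
  "direct_sum (\<lambda>_::'i::finite. P) =
    {x. (\<forall>i. 0 \<le> normalAC \<bullet> x $ i) \<and> (\<forall>\<sigma>. facet_normal \<sigma> \<bullet> x \<le> 1)}"
proof -
  have "(\<Sum>i\<in>UNIV. gaugeP (x $ i)) \<le> 1 \<longleftrightarrow> (\<forall>\<sigma>. facet_normal \<sigma> \<bullet> x \<le> 1)" for x :: "(real ^ 2) ^ 'i"
    using facet_normal_le_gaugeP[of _ x] facet_normal_eq_gaugeP[of x] by (metis order_trans)
  then show ?thesis
    unfolding direct_sum_P_eq_gaugeP by simp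
qed

lemma convex_direct_sum_P: "convex (direct_sum (\<lambda>_::'i::finite. P))"
proof -
  have "direct_sum (\<lambda>_::'i::finite. P) =
    (\<Inter>i. {x. axis i normalAC \<bullet> x \<ge> 0}) \<inter> (\<Inter>\<sigma>. {x. facet_normal \<sigma> \<bullet> x \<le> 1})"
    by (auto simp: direct_sum_P_eq inner_axis')
  also have "convex \<dots>"
    by (intro convex_Int convex_INT) (auto intro: convex_halfspace_ge convex_halfspace_le)
  finally show ?thesis .
qed

lemma zero_in_direct_sum_P: "0 \<in> direct_sum (\<lambda>_::'i::finite. P)"
  by (simp add: direct_sum_P_eq_gaugeP gaugeP_def)

lemma axis_in_direct_sum_P: "v \<in> P \<Longrightarrow> axis i v \<in> direct_sum (\<lambda>_::'i::finite. P)"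
  unfolding direct_sum_P_eq by (auto simp: P_eq) (simp add: axis_def)

lemma linear_axis: "linear (axis i :: 'a::real_vector \<Rightarrow> 'a ^ 'i::finite)"
  by (rule linearI) (auto simp: axis_def vec_eq_iff)

text \<open>A point with weights \<open>l\<close> and parts \<open>x\<close> is the convex
  combination of the points \<open>axis i (x i)\<close>, each of which lies in the hull of three
  embedded vertices.\<close>

lemma direct_sum_P_eq_hull:
  "direct_sum (\<lambda>_::'i::finite. P) = convex hull (\<Union>i. axis i ` {vertA, vertB, vertC})" (is "?D = ?H")
proof
  show "?H \<subseteq> ?D"
    using vertices_in_P by (intro hull_minimal convex_direct_sum_P) (auto intro: axis_in_direct_sum_P)
next
  show "?D \<subseteq> ?H"
  proof
    fix y assume "y \<in> ?D"
    then obtain l x where y: "y = (\<chi> i. l i *\<^sub>R x i)" and x: "\<And>i. x i \<in> P" and l: "\<And>i. 0 \<le> l i"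
      and sum: "sum l UNIV = 1"
      unfolding direct_sum_def by blast
    have ax: "axis i (x i) \<in> ?H" for i
    proof -
      have "axis i (x i) \<in> convex hull (axis i ` {vertA, vertB, vertC})"
        using x[of i] unfolding P_eq_hull by (metis convex_hull_linear_image[OF linear_axis] imageI)
      then show ?thesis
        by (rule rev_subsetD) (intro hull_mono, auto)
    qed
    have "y = (\<Sum>i\<in>UNIV. l i *\<^sub>R axis i (x i))"
      by (simp add: y vec_eq_iff axis_def if_distrib cong: if_cong)
    also have "\<dots> \<in> ?H"
      using l sum ax by (intro convex_sum convex_convex_hull finite) blast+
    finally show "y \<in> ?H" .
  qed
qed

section \<open>Vertices of the direct sum\<close>

text \<open>A unique maximiser of a linear functional is by itself a face.\<close>

lemma extreme_point_of_exposed: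
  fixes S :: "'a::real_inner set"
  assumes "convex S" "v \<in> S" "\<And>x. x \<in> S \<Longrightarrow> a \<bullet> x \<le> a \<bullet> v"
    and "\<And>x. x \<in> S \<Longrightarrow> a \<bullet> x = a \<bullet> v \<Longrightarrow> x = v"
  shows "v extreme_point_of S"
proof -
  have "S \<inter> {x. a \<bullet> x = a \<bullet> v} face_of S"
    using assms by (intro face_of_Int_supporting_hyperplane_le) auto
  moreover have "S \<inter> {x. a \<bullet> x = a \<bullet> v} = {v}"
    using assms by auto
  ultimately show ?thesis
    by (simp add: face_of_singleton)
qed

text \<open>A functional exposing \<open>v\<close> in one summand, read on component
  \<open>i\<close>, exposes \<open>axis i v\<close> in the sum. Its value is
  \<open>l i * (h \<bullet> x i)\<close>, and since \<open>h \<bullet> v\<close> is positive the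
  maximum forces all weight onto \<open>i\<close>.\<close>

lemma direct_sum_exposed:
  fixes v h :: "real ^ 2"
  assumes pos: "h \<bullet> v > 0" and max: "\<forall>p\<in>P. h \<bullet> p \<le> h \<bullet> v"
    and uniq: "\<forall>p\<in>P. h \<bullet> p = h \<bullet> v \<longrightarrow> p = v"
    and y: "y \<in> direct_sum (\<lambda>_::'i::finite. P)"
  shows "axis i h \<bullet> y \<le> h \<bullet> v" and "axis i h \<bullet> y = h \<bullet> v \<Longrightarrow> y = axis i v"
proof -
  obtain l x where y: "y = (\<chi> i. l i *\<^sub>R x i)" and x: "\<And>i. x i \<in> P" and l: "\<And>i. 0 \<le> l i"
    and sum: "sum l UNIV = 1"
    using y unfolding direct_sum_def by blast
  have split: "l i + sum l (UNIV - {i}) = 1"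
    using sum by (simp add: sum.remove[of UNIV i])
  then have li: "l i \<le> 1"
    using sum_nonneg[of "UNIV - {i}" l] l by simp
  have eq: "axis i h \<bullet> y = l i * (h \<bullet> x i)"
    by (simp add: y inner_axis')
  have "l i * (h \<bullet> x i) \<le> l i * (h \<bullet> v)"
    using l max x by (intro mult_left_mono) auto
  moreover have "l i * (h \<bullet> v) \<le> h \<bullet> v"
    using li pos by simp
  ultimately show "axis i h \<bullet> y \<le> h \<bullet> v"
    by (simp add: eq)
  assume "axis i h \<bullet> y = h \<bullet> v"
  then have "l i * (h \<bullet> v) = h \<bullet> v"
    using \<open>l i * (h \<bullet> x i) \<le> l i * (h \<bullet> v)\<close> \<open>l i * (h \<bullet> v) \<le> h \<bullet> v\<close> eq by linarith
  then have "l i = 1"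
    using pos by simp
  then have "x i = v"
    using \<open>axis i h \<bullet> y = h \<bullet> v\<close> eq x uniq by simp
  have "\<forall>j\<in>UNIV - {i}. l j = 0"
    using split \<open>l i = 1\<close> l by (subst sum_nonneg_eq_0_iff[symmetric]) auto
  then show "y = axis i v"
    using \<open>l i = 1\<close> \<open>x i = v\<close> by (auto simp: y axis_def vec_eq_iff)
qed

text \<open>Each vertex is exposed by the inward normal of the opposite edge. This is
  \<open>normalAC\<close> itself for B, and the negated normals for A and C.\<close>

lemma vertA_exposed: "\<forall>p\<in>P. - normalBC \<bullet> p \<le> - normalBC \<bullet> vertA"
    "\<forall>p\<in>P. - normalBC \<bullet> p = - normalBC \<bullet> vertA \<longrightarrow> p = vertA"
  and vertB_exposed: "\<forall>p\<in>P. normalAC \<bullet> p \<le> normalAC \<bullet> vertB"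
    "\<forall>p\<in>P. normalAC \<bullet> p = normalAC \<bullet> vertB \<longrightarrow> p = vertB"
  and vertC_exposed: "\<forall>p\<in>P. - normalAB \<bullet> p \<le> - normalAB \<bullet> vertC"
    "\<forall>p\<in>P. - normalAB \<bullet> p = - normalAB \<bullet> vertC \<longrightarrow> p = vertC"
proof -
  have le: "0 \<le> normalAC \<bullet> p" "normalAB \<bullet> p \<le> 1" "normalBC \<bullet> p \<le> 1" if "p \<in> P" for p
    using that by (auto simp: P_eq)
  note rel = normals_relation
  show "\<forall>p\<in>P. - normalBC \<bullet> p \<le> - normalBC \<bullet> vertA"
    "\<forall>p\<in>P. normalAC \<bullet> p \<le> normalAC \<bullet> vertB"
    "\<forall>p\<in>P. - normalAB \<bullet> p \<le> - normalAB \<bullet> vertC"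
    using le rel by (simp_all, smt+)
  show "\<forall>p\<in>P. - normalBC \<bullet> p = - normalBC \<bullet> vertA \<longrightarrow> p = vertA"
  proof (intro ballI impI)
    fix p assume "p \<in> P" "- normalBC \<bullet> p = - normalBC \<bullet> vertA"
    then have ac: "normalAC \<bullet> p = 0" and ab: "normalAB \<bullet> p = 1"
      using le[of p] rel[of p] by simp_all
    show "p = vertA"
      using real2_decomp_AB[of p] unfolding ac ab by simp
  qed
  show "\<forall>p\<in>P. normalAC \<bullet> p = normalAC \<bullet> vertB \<longrightarrow> p = vertB"
  proof (intro ballI impI)
    fix p assume "p \<in> P" "normalAC \<bullet> p = normalAC \<bullet> vertB"
    then have ac: "normalAC \<bullet> p = 35 / 2" and ab: "normalAB \<bullet> p = 1"
      using le[of p] rel[of p] by simp_all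
    show "p = vertB"
      using real2_decomp_AB[of p] unfolding ac ab by simp
  qed
  show "\<forall>p\<in>P. - normalAB \<bullet> p = - normalAB \<bullet> vertC \<longrightarrow> p = vertC"
  proof (intro ballI impI)
    fix p assume "p \<in> P" "- normalAB \<bullet> p = - normalAB \<bullet> vertC"
    then have ac: "normalAC \<bullet> p = 0" and bc: "normalBC \<bullet> p = 1"
      using le[of p] rel[of p] by simp_all
    show "p = vertC"
      using real2_decomp_BC[of p] unfolding ac bc by simp
  qed
qed

lemma extreme_points_direct_sum_P:
  "{v. v extreme_point_of direct_sum (\<lambda>_::'i::finite. P)} = (\<Union>i. axis i ` {vertA, vertB, vertC})"
    (is "_ = ?V")
proof
  show "{v. v extreme_point_of direct_sum (\<lambda>_::'i::finite. P)} \<subseteq> ?V"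
    unfolding direct_sum_P_eq_hull using extreme_point_of_convex_hull by blast
  have ext: "axis i v extreme_point_of direct_sum (\<lambda>_::'i::finite. P)"
    if "h \<bullet> v > 0" "v \<in> P" and max: "\<forall>p\<in>P. h \<bullet> p \<le> h \<bullet> v"
      and uniq: "\<forall>p\<in>P. h \<bullet> p = h \<bullet> v \<longrightarrow> p = v" for h v and i :: 'i
  proof (rule extreme_point_of_exposed[where a = "axis i h"])
    show "axis i h \<bullet> x \<le> axis i h \<bullet> axis i v" if "x \<in> direct_sum (\<lambda>_. P)" for x
      using direct_sum_exposed(1)[OF \<open>h \<bullet> v > 0\<close> max uniq that] by (simp add: inner_axis)
    show "x = axis i v" if "x \<in> direct_sum (\<lambda>_. P)" "axis i h \<bullet> x = axis i h \<bullet> axis i v" for x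
      using direct_sum_exposed(2)[OF \<open>h \<bullet> v > 0\<close> max uniq that(1)] that(2) by (simp add: inner_axis)
  qed (use \<open>v \<in> P\<close> in \<open>auto intro: convex_direct_sum_P axis_in_direct_sum_P\<close>)
  have "axis i vertA extreme_point_of direct_sum (\<lambda>_::'i::finite. P)" for i
    by (rule ext[OF _ vertices_in_P(1) vertA_exposed]) auto
  moreover have "axis i vertB extreme_point_of direct_sum (\<lambda>_::'i::finite. P)" for i
    by (rule ext[OF _ vertices_in_P(2) vertB_exposed]) auto
  moreover have "axis i vertC extreme_point_of direct_sum (\<lambda>_::'i::finite. P)" for i
    by (rule ext[OF _ vertices_in_P(3) vertC_exposed]) auto
  ultimately show "?V \<subseteq> {v. v extreme_point_of direct_sum (\<lambda>_::'i::finite. P)}"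
    by blast
qed

section \<open>Facets\<close>

text \<open>Different coordinate subspaces meet only in 0, so excluding 0 makes the embedded sets
  disjoint.\<close>

lemma card_UN_axis:
  fixes K :: "'i::finite \<Rightarrow> 'a::zero set"
  assumes "\<And>i. finite (K i)" "\<And>i. 0 \<notin> K i"
  shows "card (\<Union>i. axis i ` K i) = (\<Sum>i\<in>UNIV. card (K i))"
proof -
  have "inj_on (axis i) (K i)" for i
    by (rule inj_onI) (auto simp: axis_eq_axis)
  moreover have "axis i ` K i \<inter> axis j ` K j = {}" if "i \<noteq> j" for i j
    using assms(2) that by (auto simp: axis_eq_axis)
  ultimately show ?thesis
    using assms(1) by (subst card_UN_disjoint) (auto simp: card_image)
qed

lemma vertices_distinct [simp]:
  "vertA \<noteq> vertB" "vertB \<noteq> vertA" "vertA \<noteq> vertC" "vertC \<noteq> vertA" "vertB \<noteq> vertC" "vertC \<noteq> vertB"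
  and vertices_nonzero [simp]: "vertA \<noteq> 0" "0 \<noteq> vertA" "vertB \<noteq> 0" "0 \<noteq> vertB" "vertC \<noteq> 0" "0 \<noteq> vertC"
  by (auto simp: triangle_defs vec_eq_iff forall_2)

text \<open>The ends of the edge chosen in each summand; B belongs to both AB and BC.\<close>

definition facet_vertices :: "('i::finite \<Rightarrow> bool) \<Rightarrow> ((real ^ 2) ^ 'i) set" where
  "facet_vertices \<sigma> = (\<Union>i. axis i ` {vertB, if \<sigma> i then vertA else vertC})"

lemma finite_facet_vertices: "finite (facet_vertices \<sigma>)"
  by (simp add: facet_vertices_def)

lemma card_facet_vertices: "card (facet_vertices (\<sigma> :: 'i::finite \<Rightarrow> bool)) = 2 * CARD('i)"
proof -
  have "card {vertB, if \<sigma> i then vertA else vertC} = 2" for i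
    by simp
  then show ?thesis
    unfolding facet_vertices_def by (subst card_UN_axis) auto
qed

lemma vec_eq_sum_axis: "x = (\<Sum>i\<in>UNIV. axis i (x $ i))" for x :: "'a::comm_monoid_add ^ 'i::finite"
  by (simp add: vec_eq_iff axis_def)

text \<open>In every summand the two ends of the chosen edge form a basis of the plane.\<close>

lemma span_facet_vertices: "span (facet_vertices (\<sigma> :: 'i::finite \<Rightarrow> bool)) = UNIV"
proof -
  have "axis i v \<in> span (facet_vertices \<sigma>)" for i v
  proof -
    let ?w = "if \<sigma> i then vertA else vertC"
    obtain c d where v: "v = c *\<^sub>R ?w + d *\<^sub>R vertB"
      using real2_decomp_AB[of v] real2_decomp_BC[of v] by metis
    have "axis i v = c *\<^sub>R axis i ?w + d *\<^sub>R axis i vertB"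
      unfolding v by (simp only: linear_add[OF linear_axis] linear_scale[OF linear_axis])
    moreover have "axis i ?w \<in> facet_vertices \<sigma>" "axis i vertB \<in> facet_vertices \<sigma>"
      unfolding facet_vertices_def by blast+
    ultimately show ?thesis
      by (simp only: span_add span_scale span_base)
  qed
  then have "x \<in> span (facet_vertices \<sigma>)" for x
    using vec_eq_sum_axis[of x] by (metis span_sum)
  then show ?thesis
    by blast
qed

text \<open>The number of these points equals the dimension of the space they span, so they are even
  linearly independent.\<close>

lemma affine_independent_facet_vertices: "\<not> affine_dependent (facet_vertices \<sigma>)"
proof -
  have "independent (facet_vertices \<sigma>)"
    by (rule card_le_dim_spanning[where V = UNIV])
      (simp_all add: span_facet_vertices finite_facet_vertices card_facet_vertices)
  then show ?thesis
    using affine_dependent_imp_dependent by blast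
qed

lemma facet_vertices_subset: "facet_vertices \<sigma> \<subseteq> direct_sum (\<lambda>_. P)"
  using vertices_in_P by (auto simp: facet_vertices_def intro: axis_in_direct_sum_P split: if_splits)

text \<open>The affine hull is a span because the sum contains 0, and the vertices of one simplicial
  facet already span everything.\<close>

lemma affine_hull_direct_sum_P: "affine hull direct_sum (\<lambda>_::'i::finite. P) = UNIV"
proof -
  have "affine hull direct_sum (\<lambda>_::'i::finite. P) = span (direct_sum (\<lambda>_. P))"
    by (intro affine_hull_span_0 hull_inc zero_in_direct_sum_P)
  then show ?thesis
    using span_mono[OF facet_vertices_subset[of "\<lambda>_. True"]] by (simp add: span_facet_vertices top.extremum_unique)
qed

section \<open>Facets from an irredundant system of inequalities\<close>

text \<open>Restates \<open>facet_of_polyhedron_explicit\<close> for an indexed family. Irredundance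
  is given by points that violate exactly one inequality.\<close>

lemma facets_irredundant_halfspaces:
  fixes a :: "'k::finite \<Rightarrow> 'a::euclidean_space"
  assumes S: "S = {x. \<forall>k. a k \<bullet> x \<le> b k}" and full: "affine hull S = UNIV"
    and nz: "\<And>k. a k \<noteq> 0"
    and irr: "\<And>k. \<exists>x. a k \<bullet> x > b k \<and> (\<forall>j. j \<noteq> k \<longrightarrow> a j \<bullet> x \<le> b j)"
  shows "{c. c facet_of S} = range (\<lambda>k. S \<inter> {x. a k \<bullet> x = b k})"
proof -
  define h where "h k = {x. a k \<bullet> x \<le> b k}" for k
  \<comment> \<open>If two indices gave the same half-space, the point violating one inequality
    would violate the other as well.\<close>
  have "inj h"
  proof (rule injI, rule ccontr)
    fix k j assume "h k = h j" "k \<noteq> j"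
    then show False
      using irr[of k] by (force simp: h_def)
  qed
  \<comment> \<open>The explicit facet criterion reads normals and bounds off half-spaces rather
    than indices; injectivity of \<open>h\<close> makes this well defined.\<close>
  define a' where "a' H = a (inv h H)" for H
  define b' where "b' H = b (inv h H)" for H
  have [simp]: "a' (h k) = a k" "b' (h k) = b k" for k
    by (simp_all add: a'_def b'_def inv_f_f[OF \<open>inj h\<close>])
  have "c facet_of S \<longleftrightarrow> (\<exists>H. H \<in> range h \<and> c = S \<inter> {x. a' H \<bullet> x = b' H})" for c
  proof (rule facet_of_polyhedron_explicit)
    show "S = affine hull S \<inter> \<Inter>(range h)"
      using S full by (simp add: h_def Inter_eq image_def) blast
    show "a' H \<noteq> 0 \<and> H = {x. a' H \<bullet> x \<le> b' H}" if "H \<in> range h" for H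
    proof -
      obtain k where "H = h k"
        using \<open>H \<in> range h\<close> by blast
      then have "a' H = a k" "b' H = b k" "H = {x. a k \<bullet> x \<le> b k}"
        by (simp_all, simp add: h_def)
      then show ?thesis
        using nz by simp
    qed
    show "S \<subset> affine hull S \<inter> \<Inter>F'" if F': "F' \<subset> range h" for F'
    proof -
      obtain k where k: "h k \<notin> F'"
        using F' by blast
      obtain x where x: "a k \<bullet> x > b k" "\<And>j. j \<noteq> k \<Longrightarrow> a j \<bullet> x \<le> b j"
        using irr[of k] by blast
      have "x \<in> H" if "H \<in> F'" for H
      proof -
        obtain j where "H = h j"
          using F' \<open>H \<in> F'\<close> by blast
        then show ?thesis
          using x(2)[of j] k \<open>H \<in> F'\<close> by (auto simp: h_def)
      qed
      moreover have "x \<notin> S"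
        using x(1) by (auto simp: S not_le)
      moreover have "S \<subseteq> \<Inter>F'"
        using F' by (auto simp: S h_def)
      ultimately show ?thesis
        unfolding full by blast
    qed
  qed simp
  then show ?thesis
    by auto
qed

definition simplicial_facet :: "('i::finite \<Rightarrow> bool) \<Rightarrow> ((real ^ 2) ^ 'i) set" where
  "simplicial_facet \<sigma> = direct_sum (\<lambda>_. P) \<inter> {x. facet_normal \<sigma> \<bullet> x = 1}"

definition edge_facet :: "'i::finite \<Rightarrow> ((real ^ 2) ^ 'i) set" where
  "edge_facet i = direct_sum (\<lambda>_. P) \<inter> {x. normalAC \<bullet> x $ i = 0}"

lemma facet_normal_irredundant:
  fixes \<sigma> :: "'i::finite \<Rightarrow> bool"
  shows "\<exists>x. facet_normal \<sigma> \<bullet> x > 1 \<and> (\<forall>\<tau>. \<tau> \<noteq> \<sigma> \<longrightarrow> facet_normal \<tau> \<bullet> x \<le> 1) \<and> (\<forall>i. normalAC \<bullet> x $ i \<ge> 0)"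
proof -
  define n where "n = real CARD('i)"
  have n: "n \<ge> 1"
    by (simp add: n_def Suc_le_eq)
  \<comment> \<open>With the midpoint of the chosen edge in every summand, the chosen normals sum to \<open>n\<close> and any
     other choice to at most \<open>n - 5 / 6\<close>.\<close>
  define c where "c = 1 / (n - 5 / 6)"
  have c: "c > 0" "c * n > 1" "c * (n - 5 / 6) = 1"
    using n by (simp_all add: c_def field_simps)
  define m where "m i = (if \<sigma> i then (1 / 2) *\<^sub>R (vertA + vertB) else (1 / 2) *\<^sub>R (vertB + vertC))" for i
  define x :: "(real ^ 2) ^ 'i" where "x = (\<chi> i. c *\<^sub>R m i)"
  have inner: "facet_normal \<tau> \<bullet> x = (\<Sum>i\<in>UNIV. c * ((if \<tau> i then normalAB else normalBC) \<bullet> m i))" for \<tau>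
    by (simp add: facet_normal_inner x_def)
  \<comment> \<open>The normal not chosen takes the value 1/6 at the midpoint of AB and -1/4 at the
    midpoint of BC; 1/6 bounds both.\<close>
  have m: "(if \<tau> i then normalAB else normalBC) \<bullet> m i \<le> (if \<tau> i = \<sigma> i then 1 else 1 / 6)" for \<tau> i
    by (simp add: m_def inner_add_right)
  have "facet_normal \<sigma> \<bullet> x = (\<Sum>i\<in>(UNIV :: 'i set). c)"
    unfolding inner by (intro sum.cong refl) (simp add: m_def inner_add_right)
  then have "facet_normal \<sigma> \<bullet> x > 1"
    using c(2) by (simp add: n_def mult.commute)
  moreover have "facet_normal \<tau> \<bullet> x \<le> 1" if "\<tau> \<noteq> \<sigma>" for \<tau>
  proof -
    obtain j where j: "\<tau> j \<noteq> \<sigma> j"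
      using \<open>\<tau> \<noteq> \<sigma>\<close> by blast
    have "facet_normal \<tau> \<bullet> x \<le> (\<Sum>i\<in>UNIV. c * (if i = j then 1 / 6 else 1))"
      unfolding inner
    proof (rule sum_mono)
      fix i show "c * ((if \<tau> i then normalAB else normalBC) \<bullet> m i) \<le> c * (if i = j then 1 / 6 else 1)"
        using m[of \<tau> i] j c(1) by (intro mult_left_mono) (auto split: if_splits)
    qed
    also have "\<dots> = (\<Sum>i\<in>UNIV. c - (if i = j then 5 / 6 * c else 0))"
      by (intro sum.cong) auto
    also have "\<dots> = c * (n - 5 / 6)"
      by (simp add: sum_subtractf n_def algebra_simps)
    finally show ?thesis
      using c(3) by simp
  qed
  moreover have "normalAC \<bullet> x $ i \<ge> 0" for i
    using c(1) by (simp add: x_def m_def inner_add_right)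
  ultimately show ?thesis
    by blast
qed

lemma facets_direct_sum_P:
  "{F. F facet_of direct_sum (\<lambda>_::'i::finite. P)} = range simplicial_facet \<union> range edge_facet"
proof -
  let ?D = "direct_sum (\<lambda>_::'i. P)"
  define a :: "('i \<Rightarrow> bool) + 'i \<Rightarrow> (real ^ 2) ^ 'i" where
    "a = case_sum facet_normal (\<lambda>i. - axis i normalAC)"
  define b :: "('i \<Rightarrow> bool) + 'i \<Rightarrow> real" where "b = case_sum (\<lambda>_. 1) (\<lambda>_. 0)"
  have [simp]: "a (Inl \<sigma>) = facet_normal \<sigma>" "b (Inl \<sigma>) = 1" "a (Inr i) = - axis i normalAC" "b (Inr i) = 0" for \<sigma> i
    by (simp_all add: a_def b_def)
  have all_sum: "(\<forall>k. Q k) \<longleftrightarrow> (\<forall>\<sigma>. Q (Inl \<sigma>)) \<and> (\<forall>i. Q (Inr i))" for Q :: "('i \<Rightarrow> bool) + 'i \<Rightarrow> bool"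
    by (metis sum.exhaust)
  have "{c. c facet_of ?D} = range (\<lambda>k. ?D \<inter> {x. a k \<bullet> x = b k})"
  proof (rule facets_irredundant_halfspaces)
    show "?D = {x. \<forall>k. a k \<bullet> x \<le> b k}"
      unfolding all_sum by (auto simp: direct_sum_P_eq inner_axis')
    show "affine hull ?D = UNIV"
      by (rule affine_hull_direct_sum_P)
    show "a k \<noteq> 0" for k
      by (cases k) (simp_all add: facet_normal_nonzero normalAC_nonzero)
    show "\<exists>x. a k \<bullet> x > b k \<and> (\<forall>j. j \<noteq> k \<longrightarrow> a j \<bullet> x \<le> b j)" for k
    proof (cases k)
      case (Inl \<sigma>)
      then show ?thesis
        using facet_normal_irredundant[of \<sigma>] unfolding all_sum by (auto simp: inner_axis')
    next
      case (Inr i)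
      \<comment> \<open>A point just below AC: \<open>normalAC\<close> is -1/2 there, while every
        \<open>facet_normal\<close> is -1/35 and the other half plane conditions hold with
        equality.\<close>
      define v where "v = - (1 / 35) *\<^sub>R vertB"
      have "a j \<bullet> axis i v \<le> b j" if "j \<noteq> k" for j
      proof (cases j)
        case (Inl \<sigma>)
        then show ?thesis
          by (simp add: v_def)
      next
        case (Inr m)
        then have "axis i v $ m = 0"
          using \<open>j \<noteq> k\<close> \<open>k = Inr i\<close> by (simp add: axis_def)
        then show ?thesis
          using Inr by (simp add: inner_axis')
      qed
      moreover have "a k \<bullet> axis i v > b k"
        using Inr by (simp add: v_def inner_axis)
      ultimately show ?thesis
        by blast
    qed
  qed
  moreover have "(\<lambda>k. ?D \<inter> {x. a k \<bullet> x = b k}) ` range Inl = range simplicial_facet"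
    by (simp add: image_image simplicial_facet_def[abs_def])
  moreover have "(\<lambda>k. ?D \<inter> {x. a k \<bullet> x = b k}) ` range Inr = range edge_facet"
    by (simp add: image_image edge_facet_def[abs_def] inner_axis')
  ultimately show ?thesis
    by (simp add: UNIV_sum image_Un)
qed

text \<open>The vertex A of summand \<open>i\<close> detects the choice made there.\<close>

lemma inj_simplicial_facet: "inj (simplicial_facet :: ('i::finite \<Rightarrow> bool) \<Rightarrow> _)"
proof (rule injI, rule ext)
  fix \<sigma> \<tau> :: "'i \<Rightarrow> bool" and i :: 'i
  assume eq: "simplicial_facet \<sigma> = simplicial_facet \<tau>"
  have "axis i vertA \<in> simplicial_facet \<rho> \<longleftrightarrow> \<rho> i" for \<rho>
    using axis_in_direct_sum_P[OF vertices_in_P(1), of i] by (simp add: simplicial_facet_def)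
  then show "\<sigma> i = \<tau> i"
    using eq by metis
qed

lemma inj_edge_facet: "inj (edge_facet :: 'i::finite \<Rightarrow> _)"
proof (rule injI)
  fix i j :: 'i
  assume eq: "edge_facet i = edge_facet j"
  have "axis i vertB \<in> edge_facet k \<longleftrightarrow> i \<noteq> k" for k
    using axis_in_direct_sum_P[OF vertices_in_P(2), of i] by (simp add: edge_facet_def axis_def)
  then show "i = j"
    using eq by metis
qed

text \<open>A face of a hull of finitely many points is the hull of some of them, and the only
  vertices on the supporting hyperplane are those in \<open>facet_vertices\<close>.\<close>

lemma simplicial_facet_eq_hull: "simplicial_facet \<sigma> = convex hull facet_vertices \<sigma>"
proof
  have "facet_vertices \<sigma> \<subseteq> simplicial_facet \<sigma>"
    using facet_vertices_subset[of \<sigma>] by (auto simp: simplicial_facet_def facet_vertices_def)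
  moreover have "convex (simplicial_facet \<sigma>)"
    unfolding simplicial_facet_def by (intro convex_Int convex_direct_sum_P convex_hyperplane)
  ultimately show "convex hull facet_vertices \<sigma> \<subseteq> simplicial_facet \<sigma>"
    by (rule hull_minimal)
next
  let ?V = "\<Union>i. axis i ` {vertA, vertB, vertC}"
  have "simplicial_facet \<sigma> face_of direct_sum (\<lambda>_. P)"
    unfolding simplicial_facet_def
    by (intro face_of_Int_supporting_hyperplane_le convex_direct_sum_P) (simp add: direct_sum_P_eq)
  then have "simplicial_facet \<sigma> face_of convex hull ?V"
    unfolding direct_sum_P_eq_hull .
  moreover have "compact ?V"
    by (intro finite_imp_compact) simp
  ultimately obtain V' where V': "V' \<subseteq> ?V" "simplicial_facet \<sigma> = convex hull V'"
    using face_of_convex_hull_subset by blast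
  have "V' \<subseteq> facet_vertices \<sigma>"
  proof
    fix v assume "v \<in> V'"
    then have "facet_normal \<sigma> \<bullet> v = 1"
      using V'(2) hull_subset[of V' convex] by (auto simp: simplicial_facet_def)
    then show "v \<in> facet_vertices \<sigma>"
      using \<open>v \<in> V'\<close> V'(1) by (fastforce simp: facet_vertices_def split: if_splits)
  qed
  then show "simplicial_facet \<sigma> \<subseteq> convex hull facet_vertices \<sigma>"
    unfolding V'(2) by (rule hull_mono)
qed

lemma simplex_simplicial_facet:
  "(2 * int CARD('i) - 1) simplex simplicial_facet (\<sigma> :: 'i::finite \<Rightarrow> bool)"
  unfolding simplex_def
  by (rule exI[of _ "facet_vertices \<sigma>"])
    (simp add: affine_independent_facet_vertices card_facet_vertices simplicial_facet_eq_hull)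

section \<open>Combinatorial types of the facets\<close>

text \<open>Faces of an injective linear image are images of faces, so taking preimages is the
  isomorphism.\<close>

lemma combinatorially_equivalent_linear_image:
  assumes "linear f" "inj f"
  shows "combinatorially_equivalent (f ` S) S"
proof -
  have "bij_betw (\<lambda>F. f -` F) {F. F face_of f ` S} {G. G face_of S}"
    unfolding faces_of_linear_image[OF assms]
    by (rule bij_betw_byWitness[where f' = "image f"]) (auto simp: inj_vimage_image_eq assms(2))
  moreover have "F \<subseteq> F' \<longleftrightarrow> f -` F \<subseteq> f -` F'" if "F face_of f ` S" for F F'
    using face_of_imp_subset[OF that] by blast
  ultimately show ?thesis
    unfolding combinatorially_equivalent_def by blast
qed

lemma scaled_in_direct_sum_P:
  fixes x :: "(real ^ 2) ^ 'i::finite"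
  assumes x: "\<forall>i. 0 \<le> normalAC \<bullet> x $ i" "(\<Sum>i\<in>UNIV. gaugeP (x $ i)) \<le> c"
  obtains y where "y \<in> direct_sum (\<lambda>_::'i. P)" "x = c *\<^sub>R y"
proof (cases "c = 0")
  case True
  have "(\<Sum>i\<in>UNIV. gaugeP (x $ i)) = 0"
    using x(2) sum_nonneg[of UNIV "\<lambda>i. gaugeP (x $ i)"] gaugeP_nonneg x(1) True by fastforce
  then have "gaugeP (x $ i) = 0" for i
    using gaugeP_nonneg x(1) by (simp add: sum_nonneg_eq_0_iff)
  then have "x = 0"
    using gaugeP_eq_0D x(1) by (simp add: vec_eq_iff)
  then show ?thesis
    using that[of 0] zero_in_direct_sum_P by simp
next
  case False
  then have c: "c > 0"
    using x(2) sum_nonneg[of UNIV "\<lambda>i. gaugeP (x $ i)"] gaugeP_nonneg x(1) by fastforce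
  have "inverse c *\<^sub>R x \<in> direct_sum (\<lambda>_::'i. P)"
    using x c by (simp add: direct_sum_P_eq_gaugeP gaugeP_scale field_simps flip: sum_divide_distrib)
  then show ?thesis
    using that[of "inverse c *\<^sub>R x"] c by simp
qed

section \<open>Edge facets as sums of a segment and triangles\<close>

text \<open>The primitive lattice vector along AC. In this unit the edge is the segment from -2 to
  3, which places 0 strictly inside it.\<close>

definition edge_dir :: "real ^ 2" where
  "edge_dir = vector [2, - sqrt 3]"

lemma normals_edge_dir [simp]:
  "normalAC \<bullet> edge_dir = 0" "normalAB \<bullet> edge_dir = - 1 / 2" "normalBC \<bullet> edge_dir = 1 / 3"
  by (simp_all add: triangle_defs edge_dir_def inner_real2)

lemma vertA_eq_edge_dir: "vertA = (- 2) *\<^sub>R edge_dir" and vertC_eq_edge_dir: "vertC = 3 *\<^sub>R edge_dir"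
  by (simp_all add: triangle_defs edge_dir_def vec_eq_iff forall_2)

lemma gaugeP_edge_dir: "gaugeP (t *\<^sub>R edge_dir) = max (- t / 2) (t / 3)"
  by (simp add: gaugeP_def)

lemma on_edge_line:
  assumes "normalAC \<bullet> v = 0"
  obtains t where "v = t *\<^sub>R edge_dir"
proof
  have "v = (normalAB \<bullet> v - 2 / 35 * 0) *\<^sub>R (- 2) *\<^sub>R edge_dir + (2 / 35 * 0) *\<^sub>R vertB"
    using real2_decomp_AB[of v] unfolding assms vertA_eq_edge_dir .
  also have "\<dots> = (- 2 * (normalAB \<bullet> v)) *\<^sub>R edge_dir"
    by simp
  finally show "v = (- 2 * (normalAB \<bullet> v)) *\<^sub>R edge_dir" .
qed

text \<open>The real coordinate becomes the position on the line AC of summand \<open>j\<close>;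
  \<open>\<pi>\<close> numbers the remaining summands.\<close>

definition edge_embedding :: "'i \<Rightarrow> ('i \<Rightarrow> 'k) \<Rightarrow> real \<times> ((real ^ 2) ^ 'k) \<Rightarrow> (real ^ 2) ^ 'i::finite" where
  "edge_embedding j \<pi> z = (\<chi> i. if i = j then fst z *\<^sub>R edge_dir else snd z $ \<pi> i)"

lemma linear_edge_embedding: "linear (edge_embedding j \<pi>)"
  by (rule linearI) (auto simp: edge_embedding_def vec_eq_iff scaleR_add_left)

lemma inj_edge_embedding:
  assumes "bij_betw \<pi> (UNIV - {j}) (UNIV :: 'k::finite set)"
  shows "inj (edge_embedding j \<pi>)"
proof (rule linear_injective_0[THEN iffD2, OF linear_edge_embedding], intro allI impI)
  fix z assume z: "edge_embedding j \<pi> z = 0"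
  have "edge_dir \<noteq> 0"
    by (simp add: edge_dir_def vec_eq_iff forall_2)
  then have "fst z = 0"
    using arg_cong[OF z, of "\<lambda>v. v $ j"] by (simp add: edge_embedding_def)
  moreover have "snd z $ k = 0" for k
  proof -
    have "k \<in> \<pi> ` (UNIV - {j})"
      using bij_betw_imp_surj_on[OF assms] by simp
    then obtain i where "i \<noteq> j" "\<pi> i = k"
      by auto
    then show ?thesis
      using arg_cong[OF z, of "\<lambda>v. v $ i"] by (simp add: edge_embedding_def)
  qed
  ultimately show "z = 0"
    by (simp add: prod_eq_iff vec_eq_iff)
qed

text \<open>On the line AC the function \<open>gaugeP\<close> is the gauge of the segment from -2 to
  3. Both sides therefore say that the segment gauge and the triangle gauges add up to at most
  1.\<close>

lemma edge_embedding_image: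
  fixes j :: "'i::finite"
  assumes \<pi>: "bij_betw \<pi> (UNIV - {j}) (UNIV :: 'k::finite set)"
  shows "edge_embedding j \<pi> ` direct_sum2 (closed_segment (- 2) 3) (direct_sum (\<lambda>_::'k. P)) = edge_facet j"
    (is "?f ` ?Q = _")
proof
  have gaugeP_sum: "(\<Sum>i\<in>UNIV. gaugeP (?f z $ i)) = gaugeP (fst z *\<^sub>R edge_dir) + (\<Sum>k\<in>UNIV. gaugeP (snd z $ k))" for z
  proof -
    have "(\<Sum>i\<in>UNIV. gaugeP (?f z $ i)) = gaugeP (fst z *\<^sub>R edge_dir) + (\<Sum>i\<in>UNIV - {j}. gaugeP (snd z $ \<pi> i))"
      by (simp add: sum.remove[of UNIV j] edge_embedding_def)
    then show ?thesis
      using sum.reindex_bij_betw[OF \<pi>, of "\<lambda>k. gaugeP (snd z $ k)"] by simp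
  qed
  show "?f ` ?Q \<subseteq> edge_facet j"
  proof (rule image_subsetI)
    fix z assume "z \<in> ?Q"
    then obtain s t x y where z: "z = (s *\<^sub>R x, t *\<^sub>R y)" and x: "x \<in> closed_segment (- 2) 3"
      and y: "y \<in> direct_sum (\<lambda>_::'k. P)" and st: "0 \<le> s" "0 \<le> t" "s + t = 1"
      unfolding direct_sum2_def by blast
    have "- 2 \<le> x" "x \<le> 3"
      using x by (auto simp: closed_segment_eq_real_ivl split: if_splits)
    then have "gaugeP (x *\<^sub>R edge_dir) \<le> 1"
      by (simp add: gaugeP_edge_dir)
    then have "s * gaugeP (x *\<^sub>R edge_dir) \<le> s"
      using st(1) by (simp add: mult_left_le)
    moreover have "t * (\<Sum>k\<in>UNIV. gaugeP (y $ k)) \<le> t"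
      using st(2) y by (simp add: mult_left_le direct_sum_P_eq_gaugeP)
    moreover have "gaugeP (fst z *\<^sub>R edge_dir) = s * gaugeP (x *\<^sub>R edge_dir)"
      using st(1) gaugeP_scale[of s "x *\<^sub>R edge_dir"] by (simp add: z)
    moreover have "(\<Sum>k\<in>UNIV. gaugeP (snd z $ k)) = t * (\<Sum>k\<in>UNIV. gaugeP (y $ k))"
      using st(2) by (simp add: z gaugeP_scale sum_distrib_left)
    ultimately have "(\<Sum>i\<in>UNIV. gaugeP (?f z $ i)) \<le> 1"
      using st(3) unfolding gaugeP_sum by linarith
    moreover have "0 \<le> normalAC \<bullet> ?f z $ i" "normalAC \<bullet> ?f z $ j = 0" for i
      using y st(2) by (auto simp: edge_embedding_def z direct_sum_P_eq_gaugeP)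
    ultimately show "?f z \<in> edge_facet j"
      by (simp add: edge_facet_def direct_sum_P_eq_gaugeP)
  qed
  show "edge_facet j \<subseteq> ?f ` ?Q"
  proof
    fix w assume w: "w \<in> edge_facet j"
    obtain t where t: "w $ j = t *\<^sub>R edge_dir"
      using on_edge_line w by (auto simp: edge_facet_def)
    define y :: "(real ^ 2) ^ 'k" where "y = (\<chi> k. w $ the_inv_into (UNIV - {j}) \<pi> k)"
    have inj: "inj_on \<pi> (UNIV - {j})"
      using \<pi> bij_betw_imp_inj_on by blast
    have fw: "?f (t, y) = w"
      by (auto simp: vec_eq_iff edge_embedding_def y_def t the_inv_into_f_f[OF inj])
    \<comment> \<open>The triangles receive exactly the weight they need, and the segment receives
      the rest, \<open>1 - c\<close>.\<close>
    define c where "c = (\<Sum>k\<in>UNIV. gaugeP (y $ k))"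
    have "\<forall>k. 0 \<le> normalAC \<bullet> y $ k"
      using w by (simp add: y_def edge_facet_def direct_sum_P_eq_gaugeP)
    moreover from this have "0 \<le> c"
      unfolding c_def by (intro sum_nonneg gaugeP_nonneg) simp
    ultimately obtain y' where y': "y' \<in> direct_sum (\<lambda>_::'k. P)" "y = c *\<^sub>R y'"
      using scaled_in_direct_sum_P[of y c] by (auto simp: c_def)
    have "(\<Sum>i\<in>UNIV. gaugeP (w $ i)) \<le> 1"
      using w by (simp add: edge_facet_def direct_sum_P_eq_gaugeP)
    then have g: "max (- t / 2) (t / 3) \<le> 1 - c"
      using gaugeP_sum[of "(t, y)", unfolded fw fst_conv snd_conv gaugeP_edge_dir, folded c_def]
      by linarith
    have "\<exists>x\<in>closed_segment (- 2) 3. t = (1 - c) * x"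
    \<comment> \<open>With no weight left for the segment, the bound forces
      \<open>t = 0\<close>.\<close>
    proof (cases "c = 1")
      case True
      then show ?thesis
        using g by (intro bexI[of _ 0]) (auto simp: closed_segment_eq_real_ivl)
    next
      case False
      then have "1 - c > 0"
        using g by auto
      then show ?thesis
        using g by (intro bexI[of _ "t / (1 - c)"]) (auto simp: closed_segment_eq_real_ivl field_simps)
    qed
    then obtain x where x: "x \<in> closed_segment (- 2) 3" "t = (1 - c) * x"
      by blast
    have "0 \<le> 1 - c"
      using g by auto
    then have "(t, y) \<in> ?Q"
      unfolding direct_sum2_def using x y' \<open>0 \<le> c\<close> by force
    then show "w \<in> ?f ` ?Q"
      using fw by (metis imageI)
  qed
qed

lemma segment_triangles6_edge_facet: "segment_triangles6 (edge_facet (j :: 7))"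
proof -
  have "card (UNIV - {j}) = card (UNIV :: 6 set)"
    by (simp add: card_Diff_singleton)
  then obtain \<pi> :: "7 \<Rightarrow> 6" where \<pi>: "bij_betw \<pi> (UNIV - {j}) UNIV"
    using finite_same_card_bij[of "UNIV - {j}" "UNIV :: 6 set"] by auto
  have "combinatorially_equivalent (edge_facet j)
      (direct_sum2 (closed_segment (- 2 :: real) 3) (direct_sum (\<lambda>_::6. P)))"
    using combinatorially_equivalent_linear_image[OF linear_edge_embedding inj_edge_embedding[OF \<pi>]]
    by (metis edge_embedding_image[OF \<pi>])
  then show ?thesis
    unfolding segment_triangles6_def by (intro exI[of _ "- 2"] exI[of _ 3]) simp
qed

section \<open>Separating simplices from the edge facets\<close>

text \<open>Faces of a simplex correspond to subsets of its vertex set. A subset below the union of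
  two others and disjoint from both is empty, whereas \<open>Z\<close> is not.\<close>

lemma simplex_not_combinatorially_equivalent:
  fixes S :: "'a::euclidean_space set" and R :: "'b::real_vector set"
  assumes S: "n simplex S"
    and faces: "X face_of R" "Y face_of R" "Z face_of R"
    and disj: "X \<inter> Z = {}" "Y \<inter> Z = {}" and "Z \<noteq> {}"
    and join: "\<And>G. G face_of R \<Longrightarrow> X \<subseteq> G \<Longrightarrow> Y \<subseteq> G \<Longrightarrow> Z \<subseteq> G"
  shows "\<not> combinatorially_equivalent S R"
proof
  assume "combinatorially_equivalent S R"
  then obtain \<phi> where bij: "bij_betw \<phi> {F. F face_of S} {G. G face_of R}"
    and mono: "\<And>F F'. F face_of S \<Longrightarrow> F' face_of S \<Longrightarrow> F \<subseteq> F' \<longleftrightarrow> \<phi> F \<subseteq> \<phi> F'"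
    unfolding combinatorially_equivalent_def by blast
  obtain C where C: "\<not> affine_dependent C" "S = convex hull C"
    using S unfolding simplex_def by blast
  have face: "convex hull c face_of S" if "c \<subseteq> C" for c
    using that C by (auto simp: face_of_convex_hull_affine_independent)
  have face_img: "\<phi> F face_of R" if "F face_of S" for F
    using bij_betwE[OF bij] that by blast
  have ex: "\<exists>c\<subseteq>C. \<phi> (convex hull c) = G" if "G face_of R" for G
  proof -
    have "G \<in> \<phi> ` {F. F face_of S}"
      using bij_betw_imp_surj_on[OF bij] that by simp
    then obtain F where F: "F face_of S" "\<phi> F = G"
      by auto
    then obtain c where "c \<subseteq> C" "F = convex hull c"
      using face_of_convex_hull_affine_independent[OF C(1), of F] C(2) by auto
    then show ?thesis
      using F(2) by blast
  qed
  \<comment> \<open>A vertex of the simplex lying in the smaller hull is still extreme there, hence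
    one of the generators of that hull.\<close>
  have sub: "c \<subseteq> d" if "c \<subseteq> C" "d \<subseteq> C" "convex hull c \<subseteq> convex hull d" for c d
  proof
    fix v assume v: "v \<in> c"
    then have "v extreme_point_of convex hull C"
      using C that(1) by (auto simp: extreme_point_of_convex_hull_affine_independent)
    moreover have "v \<in> convex hull d" "convex hull d \<subseteq> convex hull C"
      using v that hull_subset[of c convex] hull_mono[of d C] by blast+
    ultimately have "v extreme_point_of convex hull d"
      by (auto simp: extreme_point_of_def)
    then show "v \<in> d"
      by (rule extreme_point_of_convex_hull)
  qed
  obtain x y z where x: "x \<subseteq> C" "\<phi> (convex hull x) = X" and y: "y \<subseteq> C" "\<phi> (convex hull y) = Y"
    and z: "z \<subseteq> C" "\<phi> (convex hull z) = Z"
    using ex faces by metis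
  \<comment> \<open>The empty face lies below the preimage of the empty face, and
    \<open>\<phi>\<close> preserves order.\<close>
  have bot: "\<phi> {} = {}"
  proof -
    obtain e where "e \<subseteq> C" "\<phi> (convex hull e) = {}"
      using ex[of "{}"] by auto
    then show ?thesis
      using mono[of "{}" "convex hull e"] face by auto
  qed
  \<comment> \<open>A common vertex would be sent into two disjoint faces, hence to the empty set,
    which is already the image of the empty face.\<close>
  have dis: "z \<inter> w = {}" if "w \<subseteq> C" "\<phi> (convex hull w) \<inter> Z = {}" for w
  proof (rule ccontr)
    assume "z \<inter> w \<noteq> {}"
    then obtain v where v: "v \<in> z" "v \<in> w"
      by blast
    then have "{v} \<subseteq> convex hull z" "{v} \<subseteq> convex hull w"
      using hull_subset[of z convex] hull_subset[of w convex] by auto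
    moreover have sing: "{v} face_of S"
      using face[of "{v}"] v that by auto
    ultimately have "\<phi> {v} \<subseteq> \<phi> (convex hull w)" "\<phi> {v} \<subseteq> Z"
      using mono[OF sing face] that z by auto
    then have "\<phi> {v} \<subseteq> \<phi> {}"
      using that(2) by blast
    then show False
      using mono[OF sing, of "{}"] by simp
  qed
  have "Z \<subseteq> \<phi> (convex hull (x \<union> y))"
  proof (rule join)
    have "convex hull x \<subseteq> convex hull (x \<union> y)" "convex hull y \<subseteq> convex hull (x \<union> y)"
      by (auto intro: hull_mono[THEN subsetD])
    then show "X \<subseteq> \<phi> (convex hull (x \<union> y))" "Y \<subseteq> \<phi> (convex hull (x \<union> y))"
      using mono face x y by (metis Un_least)+
    show "\<phi> (convex hull (x \<union> y)) face_of R"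
      using face_img face x y by simp
  qed
  then have "convex hull z \<subseteq> convex hull (x \<union> y)"
    using mono[of "convex hull z" "convex hull (x \<union> y)"] face x(1) y(1) z by simp
  then have "z \<subseteq> x \<union> y"
    using sub x(1) y(1) z(1) by simp
  then have "z = {}"
    using dis[of x] dis[of y] x y disj by blast
  then show False
    using z(2) bot \<open>Z \<noteq> {}\<close> by simp
qed

text \<open>Dividing by \<open>u + v\<close> gives a convex combination. The degenerate case of
  weight zero occurs when a summand carries no weight.\<close>

lemma convex_scaled_sum:
  fixes x y :: "'a::real_vector"
  assumes "convex A" "x \<in> A" "y \<in> A" "0 \<le> u" "0 \<le> v"
  shows "\<exists>z\<in>A. u *\<^sub>R x + v *\<^sub>R y = (u + v) *\<^sub>R z"
proof (cases "u + v = 0")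
  case True
  then show ?thesis
    using assms by (intro bexI[of _ x]) (auto simp: add_nonneg_eq_0_iff)
next
  case False
  then have "(u / (u + v)) *\<^sub>R x + (v / (u + v)) *\<^sub>R y \<in> A"
    using assms by (intro convexD) (auto simp: add_divide_distrib[symmetric])
  then show ?thesis
    using False by (intro bexI) (auto simp: scaleR_add_right)
qed

lemma convex_direct_sum2:
  assumes "convex A" "convex B"
  shows "convex (direct_sum2 A B)"
proof (rule convexI)
  fix p q and u v :: real
  assume p: "p \<in> direct_sum2 A B" and q: "q \<in> direct_sum2 A B" and uv: "0 \<le> u" "0 \<le> v" "u + v = 1"
  obtain s t x y where p: "p = (s *\<^sub>R x, t *\<^sub>R y)" "x \<in> A" "y \<in> B" "0 \<le> s" "0 \<le> t" "s + t = 1"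
    using p unfolding direct_sum2_def by blast
  obtain s' t' x' y' where q: "q = (s' *\<^sub>R x', t' *\<^sub>R y')" "x' \<in> A" "y' \<in> B" "0 \<le> s'" "0 \<le> t'" "s' + t' = 1"
    using q unfolding direct_sum2_def by blast
  obtain a where a: "a \<in> A" "(u * s) *\<^sub>R x + (v * s') *\<^sub>R x' = (u * s + v * s') *\<^sub>R a"
    using convex_scaled_sum[of A x x' "u * s" "v * s'"] assms p q uv by auto
  obtain b where b: "b \<in> B" "(u * t) *\<^sub>R y + (v * t') *\<^sub>R y' = (u * t + v * t') *\<^sub>R b"
    using convex_scaled_sum[of B y y' "u * t" "v * t'"] assms p q uv by auto
  have "u *\<^sub>R p + v *\<^sub>R q = ((u * s + v * s') *\<^sub>R a, (u * t + v * t') *\<^sub>R b)"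
    using a(2) b(2) by (simp add: p(1) q(1))
  moreover have "(u * s + v * s') + (u * t + v * t') = u * (s + t) + v * (s' + t')"
    by (simp add: algebra_simps)
  moreover have "0 \<le> u * s + v * s'" "0 \<le> u * t + v * t'"
    using p q uv by simp_all
  ultimately show "u *\<^sub>R p + v *\<^sub>R q \<in> direct_sum2 A B"
    unfolding direct_sum2_def using a(1) b(1) p(6) q(6) uv(3) by auto
qed

lemma direct_sum2_left:
  assumes "x \<in> A" "B \<noteq> {}"
  shows "(x, 0) \<in> direct_sum2 A B"
proof -
  obtain y where "y \<in> B"
    using assms(2) by blast
  then show ?thesis
    unfolding direct_sum2_def mem_Collect_eq using assms(1)
    by (rule_tac exI[of _ 1], rule_tac exI[of _ 0], rule_tac exI[of _ x], rule_tac exI[of _ y]) simp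
qed

lemma direct_sum2_right:
  assumes "y \<in> B" "A \<noteq> {}"
  shows "(0, y) \<in> direct_sum2 A B"
proof -
  obtain x where "x \<in> A"
    using assms(2) by blast
  then show ?thesis
    unfolding direct_sum2_def mem_Collect_eq using assms(1)
    by (rule_tac exI[of _ 0], rule_tac exI[of _ 1], rule_tac exI[of _ x], rule_tac exI[of _ y]) simp
qed

text \<open>The obstruction uses the two ends of the segment as \<open>X\<close> and
  \<open>Y\<close>, and the vertex A of one triangle as \<open>Z\<close>.\<close>

lemma simplex_not_segment_triangles6:
  fixes F :: "'a::euclidean_space set"
  assumes "n simplex F"
  shows "\<not> segment_triangles6 F"
proof
  assume "segment_triangles6 F"
  then obtain a b :: real where ab: "a < 0" "0 < b" and
    equiv: "combinatorially_equivalent F (direct_sum2 (closed_segment a b) (direct_sum (\<lambda>_::6. P)))"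
      (is "combinatorially_equivalent F ?Q")
    unfolding segment_triangles6_def by blast
  let ?D = "direct_sum (\<lambda>_::6. P)"
  have seg: "closed_segment a b = {a..b}"
    using ab by (simp add: closed_segment_eq_real_ivl)
  have convQ: "convex ?Q"
    by (intro convex_direct_sum2 convex_direct_sum_P convex_closed_segment)
  have D: "?D \<noteq> {}"
    using zero_in_direct_sum_P by blast
  have inQ: "(a, 0) \<in> ?Q" "(b, 0) \<in> ?Q" "(0, axis 0 vertA) \<in> ?Q" "(0, axis 0 vertC) \<in> ?Q"
    using ab by (auto intro!: direct_sum2_left[OF _ D] direct_sum2_right axis_in_direct_sum_P vertices_in_P)
  \<comment> \<open>The factor \<open>e\<close> is a sign that lets one argument treat both ends of
    the segment; positivity of \<open>e * c\<close> forces full weight on the segment.\<close>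
  have ext_seg: "(c, 0) extreme_point_of ?Q"
    if c: "(c, 0) \<in> ?Q" and e: "e * c > 0" "\<forall>x\<in>{a..b}. e * x \<le> e * c" for c e
  proof -
    have *: "e * fst p \<le> e * c" "e * fst p = e * c \<Longrightarrow> p = (c, 0)" if "p \<in> ?Q" for p
    proof -
      obtain s t x y where p: "p = (s *\<^sub>R x, t *\<^sub>R y)" "x \<in> {a..b}" "0 \<le> s" "0 \<le> t" "s + t = 1"
        using \<open>p \<in> ?Q\<close> unfolding direct_sum2_def seg by blast
      have le: "s * (e * x) \<le> s * (e * c)" "s * (e * c) \<le> e * c"
        using e p mult_left_mono[of "e * x" "e * c" s] mult_right_mono[of s 1 "e * c"] by auto
      then show "e * fst p \<le> e * c"
        by (simp add: p(1) mult.left_commute)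
      assume "e * fst p = e * c"
      then have "s * (e * x) = e * c"
        by (simp add: p(1) mult.left_commute)
      then have "s * (e * c) = e * c"
        using le by linarith
      then have "s = 1" "t = 0"
        using e p(5) by auto
      then show "p = (c, 0)"
        using \<open>e * fst p = e * c\<close> e(1) by (auto simp: p(1))
    qed
    show ?thesis
      by (rule extreme_point_of_exposed[OF convQ c, where a = "(e, 0)"])
        (use * in \<open>auto simp: inner_prod_def\<close>)
  qed
  have X: "{(a, 0)} face_of ?Q"
    unfolding face_of_singleton using ab by (intro ext_seg[where e = "- 1"] inQ) auto
  have Y: "{(b, 0)} face_of ?Q"
    unfolding face_of_singleton using ab by (intro ext_seg[where e = 1] inQ) auto
  have "(0, axis 0 vertA) extreme_point_of ?Q"
  proof -
    let ?h = "axis 0 (- normalBC) :: (real ^ 2) ^ 6"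
    have *: "?h \<bullet> snd p \<le> 2 / 3" "?h \<bullet> snd p = 2 / 3 \<Longrightarrow> p = (0, axis 0 vertA)" if "p \<in> ?Q" for p
    proof -
      obtain s t x y where p: "p = (s *\<^sub>R x, t *\<^sub>R y)" "y \<in> ?D" "0 \<le> s" "0 \<le> t" "s + t = 1"
        using \<open>p \<in> ?Q\<close> unfolding direct_sum2_def by blast
      have y: "?h \<bullet> y \<le> 2 / 3" "?h \<bullet> y = 2 / 3 \<Longrightarrow> y = axis 0 vertA"
        using direct_sum_exposed[OF _ vertA_exposed p(2), of 0] by simp_all
      have le: "t * (?h \<bullet> y) \<le> t * (2 / 3)" "t * (2 / 3) \<le> 2 / 3"
        using y(1) p mult_left_mono[of "?h \<bullet> y" "2 / 3" t] by auto
      then show "?h \<bullet> snd p \<le> 2 / 3"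
        by (simp add: p(1))
      assume *: "?h \<bullet> snd p = 2 / 3"
      then have "t * (2 / 3) = 2 / 3"
        using le by (simp add: p(1))
      then have "t = 1" "s = 0"
        using p by auto
      then show "p = (0, axis 0 vertA)"
        using * y(2) by (simp add: p(1))
    qed
    show ?thesis
      by (rule extreme_point_of_exposed[OF convQ inQ(3), where a = "(0, ?h)"])
        (use * in \<open>auto simp: inner_prod_def inner_axis\<close>)
  qed
  then have Z: "{(0, axis 0 vertA)} face_of ?Q"
    unfolding face_of_singleton .
  have "(0, axis 0 vertA) \<in> G" if G: "G face_of ?Q" "(a, 0) \<in> G" "(b, 0) \<in> G" for G
  proof -
    have "- a / (b - a) + b / (b - a) = 1"
      using ab by (simp add: divide_simps)
    \<comment> \<open>These weights balance the ends of the segment at 0.\<close>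
    then have "(- a / (b - a)) *\<^sub>R (b, 0 :: (real ^ 2) ^ 6) + (b / (b - a)) *\<^sub>R (a, 0) \<in> G"
      using ab by (intro convexD[OF face_of_imp_convex[OF G(1)] G(3,2)]) (simp_all add: divide_nonneg_pos divide_nonpos_pos)
    then have "(0, 0) \<in> G"
      by (simp add: mult.commute)
    \<comment> \<open>A and C are -2 and 3 times \<open>edge_dir\<close>, so 0 is strictly between
      them. A face containing 0 must contain both.\<close>
    have "0 = (3 / 5) *\<^sub>R axis 0 vertA + (2 / 5) *\<^sub>R (axis 0 vertC :: (real ^ 2) ^ 6)"
      by (simp add: vec_eq_iff axis_def vertA_eq_edge_dir vertC_eq_edge_dir)
    then have "(0, 0) = (1 - 2 / 5) *\<^sub>R (0, axis 0 vertA) + (2 / 5) *\<^sub>R (0 :: real, axis 0 vertC :: (real ^ 2) ^ 6)"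
      by simp
    moreover have "(0, axis 0 vertA) \<noteq> (0 :: real, axis 0 vertC :: (real ^ 2) ^ 6)"
      by (simp add: axis_eq_axis)
    ultimately have "(0, 0) \<in> open_segment (0, axis 0 vertA) (0 :: real, axis 0 vertC :: (real ^ 2) ^ 6)"
      unfolding in_segment by (intro conjI exI[of _ "2 / 5"]) auto
    then show ?thesis
      using face_ofD[OF G(1)] inQ \<open>(0, 0) \<in> G\<close> by blast
  qed
  then have "{(0, axis 0 vertA)} \<subseteq> G" if "G face_of ?Q" "{(a, 0)} \<subseteq> G" "{(b, 0)} \<subseteq> G" for G
    using that by simp
  moreover have "{(a, 0)} \<inter> {(0 :: real, axis 0 vertA :: (real ^ 2) ^ 6)} = {}"
    "{(b, 0)} \<inter> {(0 :: real, axis 0 vertA :: (real ^ 2) ^ 6)} = {}"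
    using ab by auto
  ultimately show False
    using simplex_not_combinatorially_equivalent[OF assms X Y Z] equiv by blast
qed

section \<open>Lattice points\<close>

lemma LambdaI:
  assumes "2 * a \<in> \<int>" "2 * b \<in> \<int>" "a + b \<in> \<int>" "v $ 1 = a" "v $ 2 = b * sqrt 3"
  shows "v \<in> Lambda"
proof -
  have "v = vector [a, b * sqrt 3]"
    using assms(4,5) by (simp add: vec_eq_iff forall_2)
  then show ?thesis
    unfolding Lambda_def using assms(1-3) by blast
qed

lemma vertices_in_Lambda: "vertA \<in> Lambda" "vertB \<in> Lambda" "vertC \<in> Lambda"
proof -
  show "vertA \<in> Lambda"
    by (rule LambdaI[of "- 4" 2]) (simp_all add: triangle_defs)
  show "vertB \<in> Lambda"
    by (rule LambdaI[of "17 / 2" "9 / 2"]) (simp_all add: triangle_defs)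
  show "vertC \<in> Lambda"
    by (rule LambdaI[of 6 "- 3"]) (simp_all add: triangle_defs)
qed

lemma axis_in_Lambda7: "v \<in> Lambda \<Longrightarrow> axis i v \<in> Lambda7"
proof -
  have "0 \<in> Lambda"
    by (rule LambdaI[of 0 0]) simp_all
  then show "v \<in> Lambda \<Longrightarrow> axis i v \<in> Lambda7"
    by (simp add: Lambda7_def axis_def)
qed

text \<open>The negation places \<open>v\<close> in the interior of \<open>T\<close>. In the
  integers \<open>k = a + b\<close> and \<open>n = 2 * b\<close> the three edge inequalities then
  have no solution.\<close>

lemma Lambda_not_in_interior_T:
  assumes "v \<in> Lambda" "0 < normalAC \<bullet> v"
  shows "1 / 7 \<le> gaugeP v"
proof (rule ccontr)
  assume *: "\<not> 1 / 7 \<le> gaugeP v"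
  obtain a b where v: "v = vector [a, b * sqrt 3]" and int: "2 * a \<in> \<int>" "2 * b \<in> \<int>" "a + b \<in> \<int>"
    using assms(1) unfolding Lambda_def by blast
  obtain k n where k: "a + b = of_int k" and n: "2 * b = of_int n"
    using int(2,3) by (auto elim!: Ints_cases)
  have "2 * k - 6 * n > - 4" "3 * k - 2 * n < 3" "2 * k + n > 0"
  proof -
    have "normalAB \<bullet> v < 1 / 7" "normalBC \<bullet> v < 1 / 7"
      using * by (auto simp: gaugeP_def)
    then have "- a + 5 * b < 2" "3 * a - b < 3" "a + 2 * b > 0"
      using assms(2) by (simp_all add: v triangle_defs inner_real2 field_simps)
    then have "real_of_int (2 * k - 6 * n) > - 4" "real_of_int (3 * k - 2 * n) < 3" "real_of_int (2 * k + n) > 0"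
      using k n by simp_all
    then show "2 * k - 6 * n > - 4" "3 * k - 2 * n < 3" "2 * k + n > 0"
      by linarith+
  qed
  then show False
    by presburger
qed

text \<open>Interior is monotone, so each defining inequality becomes strict, including the one
  whose normal attains the sum of the gauges.\<close>

lemma interior_direct_sum_P:
  fixes x :: "(real ^ 2) ^ 'i::finite"
  assumes "x \<in> interior (direct_sum (\<lambda>_::'i. P))"
  shows "0 < normalAC \<bullet> x $ i" and "(\<Sum>i\<in>UNIV. gaugeP (x $ i)) < 1"
proof -
  have int: "x \<in> interior H" if "direct_sum (\<lambda>_::'i. P) \<subseteq> H" for H
    using assms interior_mono[OF that] by blast
  have "direct_sum (\<lambda>_::'i. P) \<subseteq> {x. facet_normal \<sigma> \<bullet> x \<le> 1}" for \<sigma>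
    by (auto simp: direct_sum_P_eq)
  then have "facet_normal \<sigma> \<bullet> x < 1" for \<sigma>
    using int[of "{x. facet_normal \<sigma> \<bullet> x \<le> 1}"] by (simp add: interior_halfspace_le facet_normal_nonzero)
  then show "(\<Sum>i\<in>UNIV. gaugeP (x $ i)) < 1"
    by (metis facet_normal_eq_gaugeP)
  have "direct_sum (\<lambda>_::'i. P) \<subseteq> {x. axis i normalAC \<bullet> x \<ge> 0}"
    by (auto simp: direct_sum_P_eq inner_axis')
  then have "0 < axis i normalAC \<bullet> x"
    using int[of "{x. axis i normalAC \<bullet> x \<ge> 0}"]
    by (simp add: interior_halfspace_ge normalAC_nonzero)
  then show "0 < normalAC \<bullet> x $ i"
    by (simp add: inner_axis')
qed

text \<open>The dilation factor equals the number of summands: seven gauges of at least 1/7 already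
  reach 1.\<close>

lemma hollow_T7: "hollow Lambda7 T7"
  unfolding hollow_def
proof (rule ccontr)
  assume "interior T7 \<inter> Lambda7 \<noteq> {}"
  then obtain x where x: "x \<in> interior (direct_sum (\<lambda>_::7. P))" "x \<in> Lambda7"
    by (auto simp: T7_def)
  have "1 / 7 \<le> gaugeP (x $ i)" for i
    using Lambda_not_in_interior_T interior_direct_sum_P(1)[OF x(1)] x(2) by (simp add: Lambda7_def)
  then have "(\<Sum>i\<in>(UNIV :: 7 set). 1 / 7) \<le> (\<Sum>i\<in>UNIV. gaugeP (x $ i))"
    by (intro sum_mono)
  then show False
    using interior_direct_sum_P(2)[OF x(1)] by simp
qed

text \<open>Lies on the first lattice line above AC and parallel to it, where
  \<open>normalAC\<close> is 1/2; \<open>vertB\<close> lies on the 35th.\<close>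

definition transversal :: "real ^ 2" where
  "transversal = vector [- 1 / 2, sqrt 3 / 2]"

lemma transversal_in_Lambda: "transversal \<in> Lambda"
  by (rule LambdaI[of "- (1 / 2)" "1 / 2"]) (simp_all add: transversal_def)

lemma edge_dir_in_Lambda: "edge_dir \<in> Lambda"
  by (rule LambdaI[of 2 "- 1"]) (simp_all add: edge_dir_def)

lemma vertB_eq: "vertB = 13 *\<^sub>R edge_dir + 35 *\<^sub>R transversal"
  by (simp add: triangle_defs edge_dir_def transversal_def vec_eq_iff forall_2)

text \<open>The vectors \<open>edge_dir\<close> and \<open>transversal\<close> form a basis of the lattice.\<close>

lemma edge_dir_transversal_span:
  "v = (v $ 1 + v $ 2 / sqrt 3) *\<^sub>R edge_dir + (2 * (v $ 1) + 4 * (v $ 2) / sqrt 3) *\<^sub>R transversal"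
  by (simp add: edge_dir_def transversal_def vec_eq_iff forall_2 field_simps)

section \<open>Lattice width\<close>

text \<open>Here \<open>C - A = 5 * p\<close> settles \<open>p\<close> of absolute value at least 3.
  For smaller \<open>p\<close>, one of \<open>B - A = 15 * p + 35 * q\<close> and
  \<open>B - C = 10 * p + 35 * q\<close> has absolute value at least 15.\<close>

lemma triangle_integer_width:
  fixes p q :: int
  assumes "p \<noteq> 0 \<or> q \<noteq> 0"
  defines "A \<equiv> - 2 * p" and "B \<equiv> 13 * p + 35 * q" and "C \<equiv> 3 * p"
  shows "\<exists>u\<in>{A, B, C}. \<exists>v\<in>{A, B, C}. u - v \<ge> 15"
proof -
  have "15 \<le> C - A \<or> 15 \<le> A - C \<or> 15 \<le> B - A \<or> 15 \<le> A - B \<or> 15 \<le> B - C \<or> 15 \<le> C - B"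
  proof -
    consider "p \<ge> 3" | "p \<le> - 3" | "p = 0" | "p = 1" | "p = - 1" | "p = 2" | "p = - 2"
      by linarith
    then show ?thesis
      using assms(1) unfolding A_def B_def C_def by cases (simp_all, presburger+)
  qed
  then show ?thesis
    by auto
qed

lemma bounded_direct_sum_P: "bounded (direct_sum (\<lambda>_::'i::finite. P))"
  unfolding direct_sum_P_eq_hull by (intro bounded_convex_hull finite_imp_bounded) simp

lemma width_T7_ge:
  assumes f: "f \<in> dual_lattice Lambda7 - {\<lambda>_. 0}"
  shows "15 \<le> Sup (f ` T7) - Inf (f ` T7)"
proof -
  have lin: "linear f" and int: "\<And>x. x \<in> Lambda7 \<Longrightarrow> f x \<in> \<int>" and nz: "f \<noteq> (\<lambda>_. 0)"
    using f by (auto simp: dual_lattice_def)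
  have comb: "f (axis i (c *\<^sub>R v + d *\<^sub>R w)) = c * f (axis i v) + d * f (axis i w)" for i c d v w
    by (simp add: linear_add[OF linear_axis] linear_scale[OF linear_axis] linear_add[OF lin] linear_scale[OF lin])
  \<comment> \<open>Otherwise \<open>f\<close> would vanish on a basis of every summand, hence
    everywhere.\<close>
  have "\<exists>i. f (axis i edge_dir) \<noteq> 0 \<or> f (axis i transversal) \<noteq> 0"
  proof (rule ccontr)
    assume *: "\<nexists>i. f (axis i edge_dir) \<noteq> 0 \<or> f (axis i transversal) \<noteq> 0"
    have "f (axis i v) = 0" for i v
      by (subst edge_dir_transversal_span[of v], subst comb) (use * in simp)
    then have "f x = 0" for x
      by (subst vec_eq_sum_axis[of x]) (simp add: linear_sum[OF lin])
    then show False
      using nz by blast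
  qed
  then obtain i where i: "f (axis i edge_dir) \<noteq> 0 \<or> f (axis i transversal) \<noteq> 0"
    by blast
  obtain p q where p: "f (axis i edge_dir) = of_int p" and q: "f (axis i transversal) = of_int q"
    using int[OF axis_in_Lambda7[OF edge_dir_in_Lambda]] int[OF axis_in_Lambda7[OF transversal_in_Lambda]]
    by (metis Ints_cases)
  have val: "f (axis i vertA) = of_int (- 2 * p)" "f (axis i vertB) = of_int (13 * p + 35 * q)"
    "f (axis i vertC) = of_int (3 * p)"
    using comb[of i "- 2" edge_dir 0 0] comb[of i 13 edge_dir 35 transversal] comb[of i 3 edge_dir 0 0]
    by (simp_all add: vertA_eq_edge_dir vertB_eq vertC_eq_edge_dir p q)
  have "p \<noteq> 0 \<or> q \<noteq> 0"
    using i p q by auto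
  then obtain u v where u: "u \<in> {- 2 * p, 13 * p + 35 * q, 3 * p}" and v: "v \<in> {- 2 * p, 13 * p + 35 * q, 3 * p}"
    and uv: "u - v \<ge> 15"
    using triangle_integer_width by blast
  have mem: "f (axis i w) \<in> f ` T7" if "w \<in> P" for w
    unfolding T7_def using axis_in_direct_sum_P[OF that] by (rule imageI)
  have "of_int w \<in> f ` T7" if "w \<in> {- 2 * p, 13 * p + 35 * q, 3 * p}" for w
    using that mem[OF vertices_in_P(1)] mem[OF vertices_in_P(2)] mem[OF vertices_in_P(3)] val by auto
  then have "of_int u \<in> f ` T7" "of_int v \<in> f ` T7"
    using u v by blast+
  \<comment> \<open>Boundedness is what makes \<open>Sup\<close> and \<open>Inf\<close> actual
    bounds for the values.\<close>
  moreover have "bounded (f ` T7)"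
    unfolding T7_def using lin by (intro bounded_linear_image bounded_direct_sum_P linear_conv_bounded_linear[THEN iffD1])
  ultimately have "of_int u \<le> Sup (f ` T7)" "Inf (f ` T7) \<le> of_int v"
    by (auto intro: cSup_upper cInf_lower bounded_imp_bdd_above bounded_imp_bdd_below)
  moreover have "real_of_int u - real_of_int v \<ge> 15"
    using uv by linarith
  ultimately show ?thesis
    by linarith
qed

lemma lattice_width_T7: "lattice_width Lambda7 T7 = 15"
proof -
  \<comment> \<open>The functional with value 1 on \<open>edge_dir\<close> and 0 on
    \<open>transversal\<close>, that is \<open>a + b\<close> on the lattice. It takes its extreme
    values on the triangle at A and B, which are 15 apart.\<close>
  define n :: "real ^ 2" where "n = vector [1, 1 / sqrt 3]"
  define f :: "(real ^ 2) ^ 7 \<Rightarrow> real" where "f x = axis 0 n \<bullet> x" for x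
  have n_vert: "n \<bullet> vertA = - 2" "n \<bullet> vertB = 13" "n \<bullet> vertC = 3"
    by (simp_all add: n_def triangle_defs inner_real2)
  have "linear f"
    unfolding f_def by (simp add: linear_iff inner_add_right)
  moreover have "f x \<in> \<int>" if "x \<in> Lambda7" for x
  proof -
    have "x $ 0 \<in> Lambda"
      using that by (simp add: Lambda7_def)
    then obtain a b where "x $ 0 = vector [a, b * sqrt 3]" "a + b \<in> \<int>"
      unfolding Lambda_def by blast
    then show ?thesis
      by (simp add: f_def inner_axis' n_def inner_real2)
  qed
  moreover have "f \<noteq> (\<lambda>_. 0)"
  proof
    assume "f = (\<lambda>_. 0)"
    then have "f (axis 0 vertB) = 0"
      by simp
    then show False
      by (simp add: f_def inner_axis n_vert)
  qed
  ultimately have f: "f \<in> dual_lattice Lambda7 - {\<lambda>_. 0}"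
    by (simp add: dual_lattice_def)
  have "T7 \<subseteq> {x. axis 0 n \<bullet> x \<le> 13} \<inter> {x. axis 0 n \<bullet> x \<ge> - 2}"
    unfolding T7_def direct_sum_P_eq_hull
  proof (rule hull_minimal)
    show "(\<Union>i. axis i ` {vertA, vertB, vertC}) \<subseteq> {x. axis 0 n \<bullet> x \<le> 13} \<inter> {x. axis 0 n \<bullet> x \<ge> - 2}"
      by (auto simp: inner_axis' n_vert) (simp_all add: axis_def n_vert)
    show "convex ({x. axis 0 n \<bullet> x \<le> 13} \<inter> {x. axis 0 n \<bullet> x \<ge> - 2})"
      by (intro convex_Int convex_halfspace_le convex_halfspace_ge)
  qed
  then have bounds: "- 2 \<le> y \<and> y \<le> 13" if "y \<in> f ` T7" for y
    using that by (auto simp: f_def)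
  have "T7 \<noteq> {}"
    unfolding T7_def using zero_in_direct_sum_P by blast
  then have "Sup (f ` T7) \<le> 13" "- 2 \<le> Inf (f ` T7)"
    using bounds by (auto intro!: cSup_least cInf_greatest)
  then have "Sup (f ` T7) - Inf (f ` T7) = 15"
    using width_T7_ge[OF f] by linarith
  then show ?thesis
    unfolding lattice_width_def using f width_T7_ge
    by (intro cInf_eq_minimum) (auto simp: image_iff intro!: bexI[of _ f])
qed

theorem theorem4p2:
  shows "0 \<in> T \<and>
    lattice_polytope Lambda7 T7 \<and>
    aff_dim T7 = 14 \<and>
    hollow Lambda7 T7 \<and>
    lattice_width Lambda7 T7 = 15 \<and>
    card {v. v extreme_point_of T7} = 21 \<and>
    card {F. F facet_of T7} = 2 ^ 7 + 7 \<and>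
    card {F. F facet_of T7 \<and> 13 simplex F} = 2 ^ 7 \<and>
    card {F. F facet_of T7 \<and> segment_triangles6 F} = 7 \<and>
    (\<forall>F. F facet_of T7 \<longrightarrow> 13 simplex F \<or> segment_triangles6 F)"
proof -
  have ext: "{v. v extreme_point_of T7} = (\<Union>i. axis i ` {vertA, vertB, vertC})"
    unfolding T7_def by (rule extreme_points_direct_sum_P)
  have "card {vertA, vertB, vertC} = 3"
    by simp
  then have card_ext: "card {v. v extreme_point_of T7} = 21"
    unfolding ext by (subst card_UN_axis) auto
  have "polytope T7"
    unfolding polytope_def T7_def direct_sum_P_eq_hull by (rule exI[of _ "\<Union>i. axis i ` {vertA, vertB, vertC}"]) simp
  then have "lattice_polytope Lambda7 T7"
    unfolding lattice_polytope_def ext using axis_in_Lambda7 vertices_in_Lambda by auto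
  have zero: "0 \<in> T"
    using zero_in_P by (auto simp: dilate_def)
  have dim: "aff_dim T7 = 14"
    using aff_dim_eq_full[of T7] affine_hull_direct_sum_P[where 'i = 7] by (simp add: T7_def)
  have facets: "{F. F facet_of T7} = range simplicial_facet \<union> range edge_facet"
    unfolding T7_def by (rule facets_direct_sum_P)
  have simp: "13 simplex (simplicial_facet \<sigma>)" for \<sigma> :: "7 \<Rightarrow> bool"
    using simplex_simplicial_facet[of \<sigma>] by simp
  have not_seg: "\<not> segment_triangles6 (simplicial_facet \<sigma>)" for \<sigma> :: "7 \<Rightarrow> bool"
    using simplex_not_segment_triangles6[OF simp] .
  \<comment> \<open>The same exclusion read the other way: an edge facet has the segment form, so it
    is no simplex.\<close>
  have not_simp: "\<not> 13 simplex (edge_facet j)" for j :: 7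
    using simplex_not_segment_triangles6 segment_triangles6_edge_facet by blast
  have facet_iff: "F facet_of T7 \<longleftrightarrow> F \<in> range simplicial_facet \<or> F \<in> range edge_facet" for F
    using facets by blast
  have simplices: "{F. F facet_of T7 \<and> 13 simplex F} = range simplicial_facet"
    unfolding facet_iff using simp not_simp by auto
  have segs: "{F. F facet_of T7 \<and> segment_triangles6 F} = range edge_facet"
    unfolding facet_iff using not_seg segment_triangles6_edge_facet by auto
  have card_simp: "card (range (simplicial_facet :: (7 \<Rightarrow> bool) \<Rightarrow> _)) = 2 ^ 7"
    by (subst card_image[OF inj_simplicial_facet]) (simp add: card_fun)
  have card_edge: "card (range (edge_facet :: 7 \<Rightarrow> _)) = 7"
    by (subst card_image[OF inj_edge_facet]) simp
  have "simplicial_facet \<sigma> \<noteq> edge_facet j" for \<sigma> and j :: 7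
    using simp[of \<sigma>] not_simp[of j] by auto
  then have "range (simplicial_facet :: (7 \<Rightarrow> bool) \<Rightarrow> _) \<inter> range edge_facet = {}"
    by blast
  then have card_facets: "card {F. F facet_of T7} = 2 ^ 7 + 7"
    unfolding facets by (subst card_Un_disjoint) (simp_all add: card_simp card_edge)
  have "13 simplex F \<or> segment_triangles6 F" if "F facet_of T7" for F
    using that simp segment_triangles6_edge_facet unfolding facet_iff by auto
  then show ?thesis
    using zero \<open>lattice_polytope Lambda7 T7\<close> dim hollow_T7 lattice_width_T7 card_ext card_facets
    unfolding simplices segs card_simp card_edge by blast
qed

end
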